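(* Let generic coefficients $\gamma_{ij}\in F$ be given for all ordered pairs $(i,j)$, $i\neq j$, of vertices of $\Delta^5$, and let the permitted colorings of each pentachoron be given by the linear relations $\phi_{ij}^{(u)}=0$, where the edge functionals satisfy $\sum_{j}\gamma_{ij}\phi^{(u)}_{ij}=0$ for each vertex $i$ of each pentachoron $u$ (sum over the four edges $ij\subset u$ at $i$). Then the full hexagon holds, with multiplicities (understood as dimensions of affine subspaces) $$a_1=a_2=a_3=0,\qquad a_4=1,\qquad a_5=4 .$$ Moreover, the space of permitted colorings of $\partial\Delta^5$ is $9$-dimensional.
   Context: $\Delta^5$ is the 5-simplex with vertices $1,\dots,6$. A pentachoron is a 4-simplex and a tetrahedron is a 3-simplex; simplices are written with vertices in increasing order. Colors: $F$ is a field. A coloring assigns to every tetrahedron $t$ a column $(x_t,y_t)^{\mathrm T}\in F^2$. Edges are unoriented: $ij=ji$; but $\gamma_{ij}$ and $\gamma_{ji}$ are unrelated. "Generic" means that the $\gamma_{ij}$ lie outside the zero set of some suitable nonzero polynomial (they satisfy no accidental algebraic relation); $F$, of any characteristic, is assumed big enough to contain such elements. Rows $r_t(e)\in F^2$ ($e$ an edge of $t$), which are determined by the $\gamma$'s through the relations $\sum_j\gamma_{ij}r_t(ij)=0$ for each vertex $i$ of $t$, up to a change of basis of the color space $F^2$ of $t$: for $t=1234$, $$r(12)=\bigl(0,\ -\gamma_{13}A\bigr),\quad r(13)=\bigl(\gamma_{14}A,\ \gamma_{12}A\bigr),\quad r(14)=\bigl(-\gamma_{13}A,\ 0\bigr),$$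 $$r(23)=\bigl(-\gamma_{24}B,\ \gamma_{13}\gamma_{21}\gamma_{34}\gamma_{42}-\gamma_{12}\gamma_{24}\gamma_{31}\gamma_{43}\bigr),\quad r(24)=\bigl(\gamma_{23}B,\ D\gamma_{43}\bigr),$$ $$r(34)=\bigl(\gamma_{13}\gamma_{24}\gamma_{32}\gamma_{41}-\gamma_{14}\gamma_{23}\gamma_{31}\gamma_{42},\ -D\gamma_{42}\bigr),$$ where $A=\gamma_{24}\gamma_{32}\gamma_{43}+\gamma_{23}\gamma_{34}\gamma_{42}$, $B=\gamma_{14}\gamma_{31}\gamma_{43}+\gamma_{13}\gamma_{34}\gamma_{41}$, $D=\gamma_{13}\gamma_{21}\gamma_{32}+\gamma_{12}\gamma_{23}\gamma_{31}$. For $t=ijkl$, $i<j<k<l$, substitute $1\mapsto i$, $2\mapsto j$, $3\mapsto k$, $4\mapsto l$. Edge functionals: for an oriented pentachoron $u$ and a tetrahedron $t\subset u$, $\epsilon_t^{(u)}=+1$ if the orientation of $t$ given by the increasing order of its vertices coincides with the one induced from $u$, and $-1$ otherwise. For an edge $ij\subset u$, the edge functional on colorings of the five tetrahedra of $u$ is $\phi^{(u)}_{ij}=\sum_{t:\ ij\subset t\subset u}\epsilon_t^{(u)}\,r_t(ij)\,(x_t,y_t)^{\mathrm T}$. A coloring of $u$ is permitted if $\phi^{(u)}_{ij}=0$ for all ten edges of $u$ (this does not depend on the chosen orientation of $u$). For a subcomplex $C\subset\partial\Delta^5$ made of pentachora, a coloring of all tetrahedra of $C$, including inner ones, is permitted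 if its restriction to each pentachoron of $C$ is permitted. Full hexagon: for $1\le k\le5$, let $C\subset\partial\Delta^5$ be any subcomplex consisting of $k$ pentachora and $\bar C$ the complementary subcomplex consisting of the other $6-k$ pentachora; their common boundary $\partial C=\partial\bar C$ consists of the tetrahedra shared by a pentachoron of $C$ and a pentachoron of $\bar C$. The full hexagon with multiplicities $a_1,\dots,a_5$ holds if, for all such $C$: (1) the restrictions to $\partial C=\partial\bar C$ of permitted colorings of $C$ form the same set as the restrictions of permitted colorings of $\bar C$; (2) for each boundary coloring in this set, the permitted colorings of $C$ restricting to it form an affine space of dimension exactly $a_k$, and the permitted colorings of $\bar C$ restricting to it form an affine space of dimension exactly $a_{6-k}$. *)

theory Defs
  imports
    Complex_Main
    "HOL-Library.Function_Algebras"
    "HOL-Library.Product_Plus"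
    "HOL-Library.Poly_Mapping"
begin

section \<open>Simplices\<close>

text \<open>A simplex is identified with its set of vertices, so edges are unoriented.\<close>

definition vertices :: "nat set" where
  "vertices = {1..6}"

definition pentachora :: "nat set set" where
  "pentachora = {u. u \<subseteq> vertices \<and> card u = 5}"

definition tetrahedra :: "nat set set" where
  "tetrahedra = {t. t \<subseteq> vertices \<and> card t = 4}"

definition edges_of :: "nat set \<Rightarrow> nat set set" where
  "edges_of s = {e. e \<subseteq> s \<and> card e = 2}"

text \<open>A subcomplex made of pentachora is given by its set of pentachora.\<close>

definition tets_of :: "nat set set \<Rightarrow> nat set set" where
  "tets_of C = {t \<in> tetrahedra. \<exists>u\<in>C. t \<subseteq> u}"

definition bdry_tets :: "nat set set \<Rightarrow> nat set set" where
  "bdry_tets C = tets_of C \<inter> tets_of (pentachora - C)"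


section \<open>Colorings\<close>

text \<open>A coloring of a set \<open>T\<close> of tetrahedra is represented by a function which is zero outside
  \<open>T\<close>; the colorings of \<open>T\<close> thus form the vector space of functions from \<open>T\<close> to pairs.\<close>

type_synonym 'a coloring = "nat set \<Rightarrow> 'a \<times> 'a"

definition colorings :: "nat set set \<Rightarrow> 'a::field coloring set" where
  "colorings T = {c. \<forall>t. t \<notin> T \<longrightarrow> c t = 0}"

definition restrict_coloring :: "nat set set \<Rightarrow> 'a::field coloring \<Rightarrow> 'a coloring" where
  "restrict_coloring T c = (\<lambda>t. if t \<in> T then c t else 0)"

definition scale_coloring :: "'a::field \<Rightarrow> 'a coloring \<Rightarrow> 'a coloring" where
  "scale_coloring a c = (\<lambda>t. (a * fst (c t), a * snd (c t)))"

global_interpretation coloring: vector_space scale_coloring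
  by standard (simp_all add: scale_coloring_def fun_eq_iff prod_eq_iff algebra_simps)

definition affine_space_of_dim :: "'a::field coloring set \<Rightarrow> nat \<Rightarrow> bool" where
  "affine_space_of_dim S n \<longleftrightarrow>
     (\<exists>c B. finite B \<and> card B = n \<and> coloring.independent B \<and> S = (\<lambda>w. c + w) ` coloring.span B)"


section \<open>Rows and edge functionals\<close>

definition tet_row_ordered ::
    "(nat \<Rightarrow> nat \<Rightarrow> 'a::field) \<Rightarrow> nat \<Rightarrow> nat \<Rightarrow> nat \<Rightarrow> nat \<Rightarrow> nat set \<Rightarrow> 'a \<times> 'a" where
  "tet_row_ordered \<gamma> i j k l e =
    (let A = \<gamma> j l * \<gamma> k j * \<gamma> l k + \<gamma> j k * \<gamma> k l * \<gamma> l j;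
         B = \<gamma> i l * \<gamma> k i * \<gamma> l k + \<gamma> i k * \<gamma> k l * \<gamma> l i;
         D = \<gamma> i k * \<gamma> j i * \<gamma> k j + \<gamma> i j * \<gamma> j k * \<gamma> k i
     in if e = {i, j} then (0, - \<gamma> i k * A)
        else if e = {i, k} then (\<gamma> i l * A, \<gamma> i j * A)
        else if e = {i, l} then (- \<gamma> i k * A, 0)
        else if e = {j, k} then
          (- \<gamma> j l * B, \<gamma> i k * \<gamma> j i * \<gamma> k l * \<gamma> l j - \<gamma> i j * \<gamma> j l * \<gamma> k i * \<gamma> l k)
        else if e = {j, l} then (\<gamma> j k * B, D * \<gamma> l k)
        else if e = {k, l} then
          (\<gamma> i k * \<gamma> j l * \<gamma> k j * \<gamma> l i - \<gamma> i l * \<gamma> j k * \<gamma> k i * \<gamma> l j, - D * \<gamma> l j)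
        else (0, 0))"

definition tet_row :: "(nat \<Rightarrow> nat \<Rightarrow> 'a::field) \<Rightarrow> nat set \<Rightarrow> nat set \<Rightarrow> 'a \<times> 'a" where
  "tet_row \<gamma> t e =
    (let vs = sorted_list_of_set t in tet_row_ordered \<gamma> (vs ! 0) (vs ! 1) (vs ! 2) (vs ! 3) e)"

text \<open>An orientation of a pentachoron is a sign \<open>s\<close>, with \<open>s = 1\<close> for the increasing order of its
  vertices.  The facet omitting \<open>v\<close> occurs in the boundary of the increasingly ordered \<open>u\<close> with
  sign \<open>(-1)\<^sup>p\<close>, where \<open>p\<close> is the number of vertices of \<open>u\<close> preceding \<open>v\<close>.\<close>

definition facet_sign :: "int \<Rightarrow> nat set \<Rightarrow> nat set \<Rightarrow> int" where
  "facet_sign s u t = s * (-1) ^ card {w \<in> u. w < the_elem (u - t)}"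

definition edge_functional ::
    "(nat \<Rightarrow> nat \<Rightarrow> 'a::field) \<Rightarrow> int \<Rightarrow> nat set \<Rightarrow> nat set \<Rightarrow> 'a coloring \<Rightarrow> 'a" where
  "edge_functional \<gamma> s u e c =
    (\<Sum>t | t \<in> tetrahedra \<and> e \<subseteq> t \<and> t \<subseteq> u.
       of_int (facet_sign s u t) *
       (fst (tet_row \<gamma> t e) * fst (c t) + snd (tet_row \<gamma> t e) * snd (c t)))"

lemma edge_functional_orientation:
  "edge_functional \<gamma> s u e c = of_int s * edge_functional \<gamma> 1 u e c"
  by (simp add: edge_functional_def facet_sign_def sum_distrib_left mult.assoc)

definition permitted :: "(nat \<Rightarrow> nat \<Rightarrow> 'a::field) \<Rightarrow> nat set set \<Rightarrow> 'a coloring set" where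
  "permitted \<gamma> C =
    {c \<in> colorings (tets_of C). \<forall>u\<in>C. \<forall>e\<in>edges_of u. edge_functional \<gamma> 1 u e c = 0}"


section \<open>Full hexagon\<close>

definition full_hexagon :: "(nat \<Rightarrow> nat \<Rightarrow> 'a::field) \<Rightarrow> (nat \<Rightarrow> nat) \<Rightarrow> bool" where
  "full_hexagon \<gamma> a \<longleftrightarrow>
    (\<forall>C k. C \<subseteq> pentachora \<longrightarrow> card C = k \<longrightarrow> 1 \<le> k \<longrightarrow> k \<le> 5 \<longrightarrow>
      (let C' = pentachora - C; rs = restrict_coloring (bdry_tets C) in
        rs ` permitted \<gamma> C = rs ` permitted \<gamma> C' \<and>
        (\<forall>b \<in> rs ` permitted \<gamma> C.
           affine_space_of_dim {c \<in> permitted \<gamma> C. rs c = b} (a k) \<and>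
           affine_space_of_dim {c \<in> permitted \<gamma> C'. rs c = b} (a (6 - k)))))"


section \<open>Genericity\<close>

text \<open>Polynomials over \<open>'a\<close> in variables indexed by ordered pairs of vertices.\<close>

type_synonym 'a gpoly = "((nat \<times> nat) \<Rightarrow>\<^sub>0 nat) \<Rightarrow>\<^sub>0 'a"

definition gpoly_eval :: "'a::field gpoly \<Rightarrow> (nat \<Rightarrow> nat \<Rightarrow> 'a) \<Rightarrow> 'a" where
  "gpoly_eval P \<gamma> =
    (\<Sum>m \<in> Poly_Mapping.keys P. Poly_Mapping.lookup P m *
       (\<Prod>v \<in> Poly_Mapping.keys m. \<gamma> (fst v) (snd v) ^ Poly_Mapping.lookup m v))"

definition gpoly_vars :: "'a::field gpoly \<Rightarrow> (nat \<times> nat) set" where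
  "gpoly_vars P = (\<Union>m \<in> Poly_Mapping.keys P. Poly_Mapping.keys m)"

definition gpoly_degree_le :: "'a::field gpoly \<Rightarrow> nat \<Rightarrow> bool" where
  "gpoly_degree_le P n \<longleftrightarrow>
    (\<forall>m \<in> Poly_Mapping.keys P. (\<Sum>v \<in> Poly_Mapping.keys m. Poly_Mapping.lookup m v) \<le> n)"

text \<open>Over a finite field a nonzero polynomial may vanish at every point.  Asking for a degree
  bound which does not depend on the field excludes such a vacuous choice: a field with more
  than \<open>10 ^ 6\<close> elements always contains coefficients \<open>\<gamma>\<close> outside the zero set of the polynomial.
  The particular number is immaterial; products of the minors that express the relevant rank
  conditions have degree well below it.\<close>

definition holds_generically :: "((nat \<Rightarrow> nat \<Rightarrow> 'a::field) \<Rightarrow> bool) \<Rightarrow> bool" where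
  "holds_generically Q \<longleftrightarrow>
    (\<exists>P :: 'a gpoly. P \<noteq> 0 \<and> gpoly_vars P \<subseteq> {(i, j). i \<in> vertices \<and> j \<in> vertices \<and> i \<noteq> j} \<and>
       gpoly_degree_le P (10 ^ 6) \<and> (\<forall>\<gamma>. gpoly_eval P \<gamma> \<noteq> 0 \<longrightarrow> Q \<gamma>))"


section \<open>The linear relations between edge functionals\<close>

lemma tet_row_relation:
  fixes \<gamma> :: "nat \<Rightarrow> nat \<Rightarrow> 'a::field"
  assumes "t \<in> tetrahedra" "i \<in> t"
  shows "(\<Sum>j\<in>t - {i}. \<gamma> i j * fst (tet_row \<gamma> t {i, j})) = 0"
    and "(\<Sum>j\<in>t - {i}. \<gamma> i j * snd (tet_row \<gamma> t {i, j})) = 0"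
proof -
  define vs where "vs = sorted_list_of_set t"
  have fin: "finite t" and card: "card t = 4"
    using assms(1) by (auto simp: tetrahedra_def vertices_def intro: finite_subset)
  then have len: "length vs = 4" and set: "set vs = t" and sorted: "sorted_wrt (<) vs"
    by (simp_all add: vs_def)
  from len obtain a b c d where vs: "vs = [a, b, c, d]"
    by (auto simp: numeral_eq_Suc length_Suc_conv)
  with set sorted have t: "t = {a, b, c, d}" and lt: "a < b" "b < c" "c < d"
    by auto
  have row: "tet_row \<gamma> t e = tet_row_ordered \<gamma> a b c d e" for e
    by (simp add: tet_row_def flip: vs_def) (simp add: vs numeral_eq_Suc)
  have neq: "a \<noteq> b" "a \<noteq> c" "a \<noteq> d" "b \<noteq> c" "b \<noteq> d" "c \<noteq> d"
    using lt by auto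
  note neq' = neq neq[symmetric]
  have cases: "i = a \<or> i = b \<or> i = c \<or> i = d"
    using assms(2) t by auto
  have d: "t - {a} = {b, c, d}" "t - {b} = {a, c, d}" "t - {c} = {a, b, d}" "t - {d} = {a, b, c}"
    using t neq' by auto
  show "(\<Sum>j\<in>t - {i}. \<gamma> i j * fst (tet_row \<gamma> t {i, j})) = 0"
    using cases by (elim disjE; simp add: d row neq' tet_row_ordered_def Let_def doubleton_eq_iff;
        simp add: algebra_simps)
  show "(\<Sum>j\<in>t - {i}. \<gamma> i j * snd (tet_row \<gamma> t {i, j})) = 0"
    using cases by (elim disjE; simp add: d row neq' tet_row_ordered_def Let_def doubleton_eq_iff;
        simp add: algebra_simps)
qed

lemma edge_functional_relation:
  fixes \<gamma> :: "nat \<Rightarrow> nat \<Rightarrow> 'a::field"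
  assumes "u \<in> pentachora" "i \<in> u"
  shows "(\<Sum>j\<in>u - {i}. \<gamma> i j * edge_functional \<gamma> s u {i, j} c) = 0"
proof -
  define T where "T = {t \<in> tetrahedra. i \<in> t \<and> t \<subseteq> u}"
  define f where "f t = (of_int (facet_sign s u t) :: 'a)" for t
  define g where "g t j = f t * (fst (tet_row \<gamma> t {i, j}) * fst (c t) +
      snd (tet_row \<gamma> t {i, j}) * snd (c t))" for t j
  have finu: "finite u"
    using assms(1) by (auto simp: pentachora_def vertices_def intro: finite_subset)
  then have finT: "finite T"
    by (intro finite_subset[of T "Pow u"]) (auto simp: T_def)
  have "(\<Sum>j\<in>u - {i}. \<gamma> i j * edge_functional \<gamma> s u {i, j} c)
      = (\<Sum>j\<in>u - {i}. \<Sum>t | t \<in> T \<and> j \<in> t. \<gamma> i j * g t j)"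
    unfolding edge_functional_def sum_distrib_left g_def f_def
    by (intro sum.cong refl) (auto simp: T_def)
  also have "\<dots> = (\<Sum>t\<in>T. \<Sum>j | j \<in> u - {i} \<and> j \<in> t. \<gamma> i j * g t j)"
    using finu finT by (intro sum.swap_restrict) auto
  also have "\<dots> = 0"
  proof (rule sum.neutral, rule ballI)
    fix t assume t: "t \<in> T"
    then have eq: "{j. j \<in> u - {i} \<and> j \<in> t} = t - {i}" and t': "t \<in> tetrahedra" "i \<in> t"
      by (auto simp: T_def)
    have "(\<Sum>j\<in>t - {i}. \<gamma> i j * g t j) =
        f t * fst (c t) * (\<Sum>j\<in>t - {i}. \<gamma> i j * fst (tet_row \<gamma> t {i, j})) +
        f t * snd (c t) * (\<Sum>j\<in>t - {i}. \<gamma> i j * snd (tet_row \<gamma> t {i, j}))"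
      by (simp add: g_def sum_distrib_left sum.distrib[symmetric] algebra_simps)
    then show "(\<Sum>j | j \<in> u - {i} \<and> j \<in> t. \<gamma> i j * g t j) = 0"
      unfolding eq using tet_row_relation[OF t', of \<gamma>] by simp
  qed
  finally show ?thesis .
qed

end

theory Submission
  imports Defs "HOL-Library.Product_Lexorder"
begin

text \<open>
  The idea is to parametrize permitted colorings by weights \<open>\<psi>\<close> on the fifteen edges, in such a way
  that the only redundancy is a gauge freedom with one parameter \<open>l i\<close> per vertex, acting by
  \<open>\<psi> {i, j} \<mapsto> \<psi> {i, j} + l i * \<gamma> j i + l j * \<gamma> i j\<close>.  The dimension of the space of
  all permitted colorings is then \<open>15 - 6 = 9\<close>.

  On a single triangle every weight is a gauge, for exactly one choice of parameters
  (\<open>edge_eq_potentials\<close>, \<open>potential_of_gauge\<close>).  Let \<open>potential \<gamma> \<psi> a b c\<close> be the parameter at \<open>a\<close>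
  obtained from the triangle \<open>abc\<close>.  Two triangles with the common edge \<open>ab\<close> may disagree about the
  parameter at \<open>a\<close>, and a tetrahedron \<open>abcd\<close> records this disagreement:
  \<open>potential \<gamma> \<psi> a b c - potential \<gamma> \<psi> a b d\<close>, divided by \<open>\<gamma> a b\<close> and multiplied by the orientation
  sign of \<open>abcd\<close>, is a function of the edge \<open>ab\<close> which satisfies the same linear relations at the
  vertices of \<open>abcd\<close> as the rows do, because the differences around a vertex cancel cyclically.
  Hence it is the list of values of the rows on a unique color (\<open>color_exists\<close>), and \<open>\<psi>\<close> induces a
  coloring of all tetrahedra.  It vanishes on a tetrahedron if and only if \<open>\<psi>\<close> is a gauge there
  (\<open>induced_zero_iff\<close>).

  Induced colorings are permitted by the same cancellation, now around an edge inside a pentachoron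
  (\<open>edge_functional_induced\<close>).  Conversely, five edge weights suffice to reach any permitted
  coloring of one pentachoron (\<open>pentachoron_exact\<close>).  Weights found on different pentachora can be
  glued: where a weight is a gauge on two tetrahedra with a common triangle, the parameters agree on
  that triangle, and this provides common vertex parameters for whole families of tetrahedra
  (\<open>common_gauge\<close>).  So, for every subcomplex \<open>C\<close>, the permitted colorings are
  exactly the restrictions of induced colorings (\<open>permitted_eq_induced\<close>).  Since the weights
  live on all of \<open>\<partial>\<Delta>\<^sup>5\<close>, the equality of the two sets of boundary colorings is immediate.

  The multiplicities are the dimensions of the spaces of permitted colorings of \<open>C\<close> that vanish on
  the boundary.  After a gauge, these are induced by weights supported on the edges of \<open>C\<close> that do not
  lie in the boundary (\<open>invisible_permitted\<close>).  There are no such edges if \<open>C\<close> has at most three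
  pentachora.  For four pentachora there is one, namely the edge joining the two vertices whose
  opposite pentachora are not in \<open>C\<close>.  For five pentachora there are the five edges at one vertex
  \<open>y\<close>, with the gauge at \<open>y\<close> still acting, so the dimension is \<open>5 - 1 = 4\<close>.

  All this requires only that the \<open>\<gamma> i j\<close> and the determinants \<open>tri_det \<gamma> a b c\<close> of all triangles are
  nonzero, and the product of these expressions is the polynomial that defines genericity.
\<close>

section \<open>Vertices of simplices\<close>

text \<open>Distinct vertices listed in an arbitrary order.  Lemmas on simplices are stated for such
  lists, so that they apply to every labeling of a simplex.\<close>

abbreviation vertex_list :: "nat list \<Rightarrow> bool" where
  "vertex_list xs \<equiv> distinct xs \<and> set xs \<subseteq> vertices"

lemma tetrahedron_iff: "t \<in> tetrahedra \<longleftrightarrow> (\<exists>a b c d. vertex_list [a, b, c, d] \<and> t = {a, b, c, d})"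
proof
  assume "t \<in> tetrahedra"
  then have t: "card t = 4" "t \<subseteq> vertices" by (auto simp: tetrahedra_def)
  then have "finite t" by (auto intro: card_ge_0_finite)
  then obtain vs where vs: "set vs = t" "distinct vs"
    using finite_distinct_list by blast
  then have "length vs = 4" using t distinct_card by fastforce
  then obtain a b c d where "vs = [a, b, c, d]"
    by (auto simp: numeral_eq_Suc length_Suc_conv)
  with vs t have "vertex_list [a, b, c, d] \<and> t = {a, b, c, d}" by auto
  then show "\<exists>a b c d. vertex_list [a, b, c, d] \<and> t = {a, b, c, d}" by blast
qed (auto simp: tetrahedra_def)

lemma edges_of_tetrahedron:
  assumes "distinct [a, b, c, d]"
  shows "edges_of {a, b, c, d} = {{a, b}, {a, c}, {a, d}, {b, c}, {b, d}, {c, d}}"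
proof
  show "edges_of {a, b, c, d} \<subseteq> {{a, b}, {a, c}, {a, d}, {b, c}, {b, d}, {c, d}}"
  proof
    fix e assume "e \<in> edges_of {a, b, c, d}"
    then have "card e = 2" and sub: "e \<subseteq> {a, b, c, d}"
      by (auto simp: edges_of_def)
    then obtain x y where e: "e = {x, y}" "x \<noteq> y"
      by (auto simp: card_2_iff)
    with sub have "x \<in> {a, b, c, d}" "y \<in> {a, b, c, d}" by auto
    then show "e \<in> {{a, b}, {a, c}, {a, d}, {b, c}, {b, d}, {c, d}}"
      using e by (elim insertE emptyE) (simp_all add: doubleton_eq_iff)
  qed
  show "{{a, b}, {a, c}, {a, d}, {b, c}, {b, d}, {c, d}} \<subseteq> edges_of {a, b, c, d}"
    using assms unfolding edges_of_def by (auto simp: card_insert_if)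
qed

lemma ordered_labels:
  assumes "t \<in> tetrahedra"
  obtains i j k l where "vertex_list [i, j, k, l]" "i < j" "j < k" "k < l" "t = {i, j, k, l}"
proof -
  have t: "t \<subseteq> vertices" "card t = 4" "finite t"
    using assms by (auto simp: tetrahedra_def vertices_def intro: finite_subset)
  obtain vs where vs: "sorted_list_of_set t = vs" by blast
  then have "length vs = 4" using t by auto
  then obtain i j k l where "vs = [i, j, k, l]"
    by (auto simp: numeral_eq_Suc length_Suc_conv)
  with vs have s: "sorted_list_of_set t = [i, j, k, l]" by simp
  then have "t = {i, j, k, l}"
    using set_sorted_list_of_set[OF t(3)] by auto
  moreover have "sorted_wrt (<) [i, j, k, l]"
    unfolding s[symmetric] by simp
  ultimately show ?thesis
    using t by (intro that[of i j k l]) auto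
qed

lemma pentachoron_label:
  assumes "u \<in> pentachora"
  obtains v where "v \<in> vertices" "u = vertices - {v}"
proof -
  have u: "u \<subseteq> vertices" "card u = 5" using assms by (auto simp: pentachora_def)
  then have "card (vertices - u) = 1"
    by (subst card_Diff_subset) (auto simp: vertices_def intro: finite_subset)
  then obtain v where "vertices - u = {v}" by (auto simp: card_1_singleton_iff)
  with u have "v \<in> vertices" "u = vertices - {v}" by auto
  then show ?thesis using that by blast
qed

lemma tetrahedron_label:
  assumes "vertex_list [x, y]"
  shows "vertices - {x, y} \<in> tetrahedra"
  using assms by (auto simp: tetrahedra_def card_Diff_subset) (simp add: vertices_def)

lemma pentachoron_edge_labels:
  assumes "u \<in> pentachora" "e \<in> edges_of u"
  obtains a b c d v where "vertex_list [a, b, c, d, v]" "u = {a, b, c, d, v}" "e = {a, b}"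
proof -
  have u: "u \<subseteq> vertices" "card u = 5" and e: "e \<subseteq> u" "card e = 2"
    using assms by (auto simp: pentachora_def edges_of_def)
  obtain a b where ab: "e = {a, b}" "a \<noteq> b" using e by (auto simp: card_2_iff)
  have "finite u" using u(2) by (auto intro: card_ge_0_finite)
  then have "card (u - e) = 3" using u e by (subst card_Diff_subset) (auto intro: finite_subset)
  then obtain c d v where "u - e = {c, d, v}" "c \<noteq> d" "c \<noteq> v" "d \<noteq> v"
    by (auto simp: card_3_iff)
  moreover from this have "u = {a, b, c, d, v}" using ab e by blast
  ultimately show ?thesis using ab u e
    by (intro that[of a b c d v]) auto
qed

lemma vertices_eq: "vertices = {1, 2, 3, 4, 5, 6}"
  by (auto simp: vertices_def)

lemma tetrahedra_of_pentachoron: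
  assumes "t \<in> tetrahedra" "t \<subseteq> {a, b, c, d, v}" "distinct [a, b, c, d, v]"
  shows "t \<in> {{a, b, c, d}, {a, b, c, v}, {a, b, d, v}, {a, c, d, v}, {b, c, d, v}}"
proof -
  let ?u = "{a, b, c, d, v}"
  have "card (?u - t) = 1"
    using assms by (subst card_Diff_subset) (auto simp: tetrahedra_def intro: finite_subset)
  then obtain x where x: "?u - t = {x}" by (auto simp: card_1_singleton_iff)
  then have "x \<in> ?u" and "t = ?u - {x}" using assms by blast+
  then show ?thesis using assms(3) by auto
qed

lemma tets_ofI: "t \<in> tetrahedra \<Longrightarrow> u \<in> C \<Longrightarrow> t \<subseteq> u \<Longrightarrow> t \<in> tets_of C"
  by (auto simp: tets_of_def)

lemma tets_of_pentachora: "tets_of pentachora = tetrahedra"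
proof (intro equalityI subsetI)
  fix t assume t: "t \<in> tetrahedra"
  then have "card (vertices - t) = 2" "t \<subseteq> vertices"
    by (auto simp: tetrahedra_def card_Diff_subset finite_subset[of t vertices] vertices_def)
  then obtain v where v: "v \<in> vertices" "v \<notin> t" by (metis card_2_iff Diff_iff insertI1)
  then have "vertices - {v} \<in> pentachora" by (auto simp: pentachora_def) (simp add: vertices_def)
  then show "t \<in> tets_of pentachora"
    by (rule tets_ofI[OF t]) (use v \<open>t \<subseteq> vertices\<close> in blast)
qed (auto simp: tets_of_def)

lemma double_complement: "C \<subseteq> pentachora \<Longrightarrow> pentachora - (pentachora - C) = C"
  by blast

text \<open>A set of pentachora is encoded by the set of vertices opposite to them.  A tetrahedron is the
  complement of two vertices \<open>x\<close> and \<open>y\<close>, and it is a boundary tetrahedron of \<open>C\<close> exactly if one of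
  them belongs to \<open>omitted C\<close> and the other one does not.\<close>

definition omitted :: "nat set set \<Rightarrow> nat set" where
  "omitted C = {v \<in> vertices. vertices - {v} \<in> C}"

lemma omitted_subset: "omitted C \<subseteq> vertices"
  by (auto simp: omitted_def)

lemma omitted_complement: "omitted (pentachora - C) = vertices - omitted C"
  by (auto simp: omitted_def pentachora_def) (simp add: vertices_def)

lemma card_omitted:
  assumes "C \<subseteq> pentachora"
  shows "card (omitted C) = card C"
proof -
  have "bij_betw (\<lambda>v. vertices - {v}) (omitted C) C"
  proof (rule bij_betwI')
    fix u assume "u \<in> C"
    with assms obtain v where "v \<in> vertices" "u = vertices - {v}"
      using pentachoron_label by blast
    with \<open>u \<in> C\<close> show "\<exists>v\<in>omitted C. u = vertices - {v}"
      by (auto simp: omitted_def)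
  qed (auto simp: omitted_def)
  then show ?thesis by (rule bij_betw_same_card)
qed

lemma tets_of_iff:
  assumes "C \<subseteq> pentachora"
  shows "t \<in> tets_of C \<longleftrightarrow> t \<in> tetrahedra \<and> (\<exists>x\<in>omitted C. x \<notin> t)"
proof
  assume t: "t \<in> tets_of C"
  then obtain u where u: "u \<in> C" "t \<subseteq> u" "t \<in> tetrahedra" by (auto simp: tets_of_def)
  with assms obtain v where "v \<in> vertices" "u = vertices - {v}"
    using pentachoron_label by blast
  with u show "t \<in> tetrahedra \<and> (\<exists>x\<in>omitted C. x \<notin> t)"
    by (auto simp: omitted_def)
next
  assume "t \<in> tetrahedra \<and> (\<exists>x\<in>omitted C. x \<notin> t)"
  then obtain x where x: "t \<in> tetrahedra" "x \<in> omitted C" "x \<notin> t" by blast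
  then show "t \<in> tets_of C"
    by (intro tets_ofI[of t "vertices - {x}"]) (auto simp: omitted_def tetrahedra_def)
qed

lemma bdry_tets_iff:
  assumes "C \<subseteq> pentachora"
  shows "t \<in> bdry_tets C \<longleftrightarrow>
    t \<in> tetrahedra \<and> (\<exists>x\<in>omitted C. x \<notin> t) \<and> (\<exists>y\<in>vertices - omitted C. y \<notin> t)"
  unfolding bdry_tets_def Int_iff tets_of_iff[OF assms] tets_of_iff[OF Diff_subset] omitted_complement
  by blast

lemma bdry_tets_complement: "C \<subseteq> pentachora \<Longrightarrow> bdry_tets (pentachora - C) = bdry_tets C"
  by (simp add: bdry_tets_def double_complement Int_commute)

section \<open>Gauge on a triangle\<close>

text \<open>Up to sign, the determinant of the system \<open>\<psi> {i, j} = l i * \<gamma> j i + l j * \<gamma> i j\<close>, with the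
  three edges of a triangle as equations and the three parameters \<open>l i\<close> as unknowns.
  The factors \<open>A\<close>, \<open>B\<close>, \<open>D\<close> in the rows of a tetrahedron are such determinants for three of its
  faces.\<close>

definition tri_det :: "(nat \<Rightarrow> nat \<Rightarrow> 'a::field) \<Rightarrow> nat \<Rightarrow> nat \<Rightarrow> nat \<Rightarrow> 'a" where
  "tri_det \<gamma> a b c = \<gamma> a b * \<gamma> b c * \<gamma> c a + \<gamma> a c * \<gamma> c b * \<gamma> b a"

text \<open>The parameter \<open>l a\<close> of the solution of that system on the triangle \<open>abc\<close>, by Cramer's rule.\<close>

definition potential ::
    "(nat \<Rightarrow> nat \<Rightarrow> 'a::field) \<Rightarrow> (nat set \<Rightarrow> 'a) \<Rightarrow> nat \<Rightarrow> nat \<Rightarrow> nat \<Rightarrow> 'a" where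
  "potential \<gamma> \<psi> a b c =
    (\<gamma> a c * \<gamma> c b * \<psi> {a, b} + \<gamma> a b * \<gamma> b c * \<psi> {a, c} - \<gamma> a b * \<gamma> a c * \<psi> {b, c})
      / tri_det \<gamma> a b c"

text \<open>The minimum and the maximum merely name the two ends of the edge; the expression is symmetric
  in them (\<open>gauge_edge\<close>).\<close>

definition gauge :: "(nat \<Rightarrow> nat \<Rightarrow> 'a::field) \<Rightarrow> (nat \<Rightarrow> 'a) \<Rightarrow> nat set \<Rightarrow> 'a" where
  "gauge \<gamma> l e = l (Min e) * \<gamma> (Max e) (Min e) + l (Max e) * \<gamma> (Min e) (Max e)"

lemma gauge_edge: "i \<noteq> j \<Longrightarrow> gauge \<gamma> l {i, j} = l i * \<gamma> j i + l j * \<gamma> i j"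
  by (cases "i < j") (auto simp: gauge_def)

lemma gauge_cong:
  assumes "e \<in> edges_of A" "\<And>i. i \<in> A \<Longrightarrow> l i = l' i"
  shows "gauge \<gamma> l e = gauge \<gamma> l' e"
proof -
  obtain i j where "e = {i, j}" "i \<noteq> j" "i \<in> A" "j \<in> A"
    using assms(1) by (auto simp: edges_of_def card_2_iff)
  with assms(2) show ?thesis by (simp add: gauge_edge)
qed

lemma gauge_zero: "gauge \<gamma> (\<lambda>_. 0) e = 0"
  by (simp add: gauge_def)

lemma potential_swap: "potential \<gamma> \<psi> a c b = potential \<gamma> \<psi> a b c"
  by (simp add: potential_def tri_det_def insert_commute algebra_simps)

lemma potential_add:
  "potential \<gamma> (\<lambda>e. \<psi> e + \<phi> e) a b c = potential \<gamma> \<psi> a b c + potential \<gamma> \<phi> a b c"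
  by (simp add: potential_def add_divide_distrib [symmetric] algebra_simps)

lemma potential_scale: "potential \<gamma> (\<lambda>e. x * \<psi> e) a b c = x * potential \<gamma> \<psi> a b c"
  by (simp add: potential_def algebra_simps)

lemma potential_zero:
  "\<psi> {a, b} = 0 \<Longrightarrow> \<psi> {a, c} = 0 \<Longrightarrow> \<psi> {b, c} = 0 \<Longrightarrow> potential \<gamma> \<psi> a b c = 0"
  by (simp add: potential_def)

locale generic_coefficients =
  fixes \<gamma> :: "nat \<Rightarrow> nat \<Rightarrow> 'a::field"
  assumes coeff_nonzero: "vertex_list [i, j] \<Longrightarrow> \<gamma> i j \<noteq> 0"
    and tri_det_nonzero: "vertex_list [a, b, c] \<Longrightarrow> tri_det \<gamma> a b c \<noteq> 0"
begin

lemma edge_eq_potentials: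
  assumes "vertex_list [a, b, c]"
  shows "\<psi> {a, b} = potential \<gamma> \<psi> a b c * \<gamma> b a + potential \<gamma> \<psi> b a c * \<gamma> a b"
proof -
  have *: "tri_det \<gamma> b a c = tri_det \<gamma> a b c"
    by (simp add: tri_det_def)
  have "potential \<gamma> \<psi> a b c * \<gamma> b a + potential \<gamma> \<psi> b a c * \<gamma> a b =
     (\<psi> {a, b} * tri_det \<gamma> a b c) / tri_det \<gamma> a b c"
    unfolding potential_def * times_divide_eq_left add_divide_distrib [symmetric]
    by (rule arg_cong[where f = "\<lambda>x. x / _"])
      (simp add: insert_commute tri_det_def algebra_simps)
  then show ?thesis using tri_det_nonzero[OF assms] by simp
qed

lemma potential_of_gauge:
  assumes "vertex_list [a, b, c]"
    and "\<psi> {a, b} = l a * \<gamma> b a + l b * \<gamma> a b"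
    and "\<psi> {a, c} = l a * \<gamma> c a + l c * \<gamma> a c"
    and "\<psi> {b, c} = l b * \<gamma> c b + l c * \<gamma> b c"
  shows "potential \<gamma> \<psi> a b c = l a"
proof -
  have "potential \<gamma> \<psi> a b c = l a * tri_det \<gamma> a b c / tri_det \<gamma> a b c"
    unfolding potential_def assms
    by (rule arg_cong[where f = "\<lambda>x. x / _"]) (simp add: tri_det_def algebra_simps)
  then show ?thesis using tri_det_nonzero[OF assms(1)] by simp
qed

lemma gauge_zero_on_triangle:
  assumes "vertex_list [a, b, c]" "gauge \<gamma> l {a, b} = 0" "gauge \<gamma> l {a, c} = 0" "gauge \<gamma> l {b, c} = 0"
  shows "l a = 0"
proof -
  have "potential \<gamma> (gauge \<gamma> l) a b c = l a"
    by (rule potential_of_gauge) (use assms(1) in \<open>auto simp: gauge_edge\<close>)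
  then show ?thesis
    using potential_zero[of "gauge \<gamma> l" a b c \<gamma>] assms by simp
qed

lemma triangle_gauge:
  assumes "vertex_list [a, b, c]"
  shows "\<exists>l. \<forall>e\<in>edges_of {a, b, c}. \<psi> e = gauge \<gamma> l e"
proof -
  define l where "l i = (if i = a then potential \<gamma> \<psi> a b c else if i = b then potential \<gamma> \<psi> b a c
    else potential \<gamma> \<psi> c a b)" for i
  have l: "l a = potential \<gamma> \<psi> a b c" "l b = potential \<gamma> \<psi> b a c" "l c = potential \<gamma> \<psi> c a b"
    using assms by (auto simp: l_def)
  have "\<psi> {a, b} = gauge \<gamma> l {a, b}" "\<psi> {a, c} = gauge \<gamma> l {a, c}" "\<psi> {b, c} = gauge \<gamma> l {b, c}"
    using edge_eq_potentials[of a b c \<psi>] edge_eq_potentials[of a c b \<psi>] edge_eq_potentials[of b c a \<psi>] assms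
    by (auto simp: gauge_edge l potential_swap[of \<gamma> \<psi> b c a] potential_swap[of \<gamma> \<psi> c b a]
        potential_swap[of \<gamma> \<psi> a c b])
  moreover have "edges_of {a, b, c} \<subseteq> {{a, b}, {a, c}, {b, c}}"
  proof
    fix e assume "e \<in> edges_of {a, b, c}"
    then obtain x y where "e = {x, y}" "x \<noteq> y" "x \<in> {a, b, c}" "y \<in> {a, b, c}"
      by (auto simp: edges_of_def card_2_iff)
    then show "e \<in> {{a, b}, {a, c}, {b, c}}"
      by (elim insertE emptyE) (simp_all add: doubleton_eq_iff)
  qed
  ultimately show ?thesis by (intro exI[of _ l]) blast
qed

end

section \<open>The color space of a tetrahedron\<close>

definition row_value ::
    "(nat \<Rightarrow> nat \<Rightarrow> 'a::field) \<Rightarrow> nat set \<Rightarrow> nat set \<Rightarrow> 'a \<times> 'a \<Rightarrow> 'a" where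
  "row_value \<gamma> t e p = fst (tet_row \<gamma> t e) * fst p + snd (tet_row \<gamma> t e) * snd p"

lemma row_value_add: "row_value \<gamma> t e (p + q) = row_value \<gamma> t e p + row_value \<gamma> t e q"
  by (simp add: row_value_def algebra_simps)

lemma row_value_diff: "row_value \<gamma> t e (p - q) = row_value \<gamma> t e p - row_value \<gamma> t e q"
  by (simp add: row_value_def algebra_simps)

lemma row_value_zero [simp]: "row_value \<gamma> t e 0 = 0"
  by (simp add: row_value_def)

text \<open>These are the relations that determine the rows of a tetrahedron up to a change of basis; all
  functions on edges that come from a color satisfy them.\<close>

definition vertex_relations ::
    "(nat \<Rightarrow> nat \<Rightarrow> 'a::field) \<Rightarrow> nat set \<Rightarrow> (nat set \<Rightarrow> 'a) \<Rightarrow> bool" where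
  "vertex_relations \<gamma> t x \<longleftrightarrow> (\<forall>i\<in>t. (\<Sum>j\<in>t - {i}. \<gamma> i j * x {i, j}) = 0)"

lemma vertex_relations_row_value:
  assumes "t \<in> tetrahedra"
  shows "vertex_relations \<gamma> t (\<lambda>e. row_value \<gamma> t e p)"
  unfolding vertex_relations_def
proof
  fix i assume i: "i \<in> t"
  have "(\<Sum>j\<in>t - {i}. \<gamma> i j * row_value \<gamma> t {i, j} p) =
      fst p * (\<Sum>j\<in>t - {i}. \<gamma> i j * fst (tet_row \<gamma> t {i, j})) +
      snd p * (\<Sum>j\<in>t - {i}. \<gamma> i j * snd (tet_row \<gamma> t {i, j}))"
    by (simp add: row_value_def sum_distrib_left sum.distrib[symmetric] algebra_simps)
  then show "(\<Sum>j\<in>t - {i}. \<gamma> i j * row_value \<gamma> t {i, j} p) = 0"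
    using tet_row_relation[OF assms i, of \<gamma>] by simp
qed

lemma vertex_relations_diff:
  "vertex_relations \<gamma> t x \<Longrightarrow> vertex_relations \<gamma> t y \<Longrightarrow> vertex_relations \<gamma> t (\<lambda>e. x e - y e)"
  by (simp add: vertex_relations_def right_diff_distrib sum_subtractf)

lemma vertex_relations_iff:
  assumes "distinct [a, b, c, d]"
  shows "vertex_relations \<gamma> {a, b, c, d} x \<longleftrightarrow>
    \<gamma> a b * x {a, b} + \<gamma> a c * x {a, c} + \<gamma> a d * x {a, d} = 0 \<and>
    \<gamma> b a * x {a, b} + \<gamma> b c * x {b, c} + \<gamma> b d * x {b, d} = 0 \<and>
    \<gamma> c a * x {a, c} + \<gamma> c b * x {b, c} + \<gamma> c d * x {c, d} = 0 \<and>
    \<gamma> d a * x {a, d} + \<gamma> d b * x {b, d} + \<gamma> d c * x {c, d} = 0"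
proof -
  have "{a, b, c, d} - {a} = {b, c, d}" "{a, b, c, d} - {b} = {a, c, d}"
    "{a, b, c, d} - {c} = {a, b, d}" "{a, b, c, d} - {d} = {a, b, c}"
    using assms by auto
  then show ?thesis
    using assms by (simp add: vertex_relations_def insert_commute add.assoc)
qed

context generic_coefficients
begin

text \<open>Four relations among six unknowns leave two degrees of freedom, and the values on two edges at
  a common vertex fix them: the relation at \<open>a\<close> removes the third edge at \<open>a\<close>, and the relations at
  \<open>b\<close>, \<open>c\<close>, \<open>d\<close> form a system for the triangle \<open>bcd\<close> whose determinant is, up to sign,
  \<open>tri_det \<gamma> b c d\<close>.\<close>

lemma vertex_relations_zero:
  assumes vl: "vertex_list [a, b, c, d]" and rel: "vertex_relations \<gamma> {a, b, c, d} x"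
    and zero: "x {a, b} = 0" "x {a, c} = 0"
    and e: "e \<in> edges_of {a, b, c, d}"
  shows "x e = 0"
proof -
  have ad: "x {a, d} = 0"
    and b: "\<gamma> b c * x {b, c} + \<gamma> b d * x {b, d} = 0"
    and c: "\<gamma> c b * x {b, c} + \<gamma> c d * x {c, d} = 0"
    and d: "\<gamma> d b * x {b, d} + \<gamma> d c * x {c, d} = 0"
    using rel zero coeff_nonzero[of a d] vl by (auto simp: vertex_relations_iff)
  have "tri_det \<gamma> b c d * x {b, c} = \<gamma> c d * \<gamma> d b * (\<gamma> b c * x {b, c} + \<gamma> b d * x {b, d})
     + \<gamma> b d * \<gamma> d c * (\<gamma> c b * x {b, c} + \<gamma> c d * x {c, d})
     - \<gamma> b d * \<gamma> c d * (\<gamma> d b * x {b, d} + \<gamma> d c * x {c, d})"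
    by (simp add: tri_det_def algebra_simps)
  then have bc: "x {b, c} = 0"
    unfolding b c d using tri_det_nonzero[of b c d] vl by auto
  have "x {b, d} = 0" "x {c, d} = 0"
    using b c bc coeff_nonzero[of b d] coeff_nonzero[of c d] vl by auto
  then show ?thesis
    using e bc ad zero vl by (auto simp: edges_of_tetrahedron)
qed

text \<open>For the increasing order of vertices, these two rows read off the two coordinates of the color.
  Apart from the vertex relations, nothing else about the explicit rows enters the argument.\<close>

lemma ordered_row_values:
  assumes vl: "vertex_list [i, j, k, l]" and lt: "i < j" "j < k" "k < l"
  shows "row_value \<gamma> {i, j, k, l} {i, j} p = - \<gamma> i k * tri_det \<gamma> j k l * snd p"
    and "row_value \<gamma> {i, j, k, l} {i, l} p = - \<gamma> i k * tri_det \<gamma> j k l * fst p"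
proof -
  have s: "sorted_list_of_set {i, j, k, l} = [i, j, k, l]"
    using lt by (intro sorted_list_of_set_unique[THEN iffD1]) auto
  have row: "tet_row \<gamma> {i, j, k, l} e = tet_row_ordered \<gamma> i j k l e" for e
    unfolding tet_row_def s by (simp add: numeral_eq_Suc)
  show "row_value \<gamma> {i, j, k, l} {i, j} p = - \<gamma> i k * tri_det \<gamma> j k l * snd p"
    and "row_value \<gamma> {i, j, k, l} {i, l} p = - \<gamma> i k * tri_det \<gamma> j k l * fst p"
    unfolding row_value_def row using vl
    by (auto simp: tet_row_ordered_def Let_def doubleton_eq_iff tri_det_def algebra_simps)
qed

lemma color_zero:
  assumes vl: "vertex_list [a, b, c, d]"
    and "row_value \<gamma> {a, b, c, d} {a, b} p = 0" "row_value \<gamma> {a, b, c, d} {a, c} p = 0"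
  shows "p = 0"
proof -
  let ?t = "{a, b, c, d}"
  have t: "?t \<in> tetrahedra"
    using vl by (auto simp: tetrahedron_iff)
  have zero: "\<forall>e\<in>edges_of ?t. row_value \<gamma> ?t e p = 0"
    using vertex_relations_zero[OF vl vertex_relations_row_value[OF t]] assms(2,3) by blast
  obtain i j k l where ijkl: "vertex_list [i, j, k, l]" "i < j" "j < k" "k < l" "?t = {i, j, k, l}"
    using ordered_labels[OF t] by metis
  have "row_value \<gamma> ?t {i, j} p = 0" "row_value \<gamma> ?t {i, l} p = 0"
    using zero ijkl(1) unfolding ijkl(5) by (auto simp: edges_of_tetrahedron)
  then have "snd p = 0" "fst p = 0"
    unfolding ijkl(5) ordered_row_values[OF ijkl(1-4)]
    using coeff_nonzero[of i k] tri_det_nonzero[of j k l] ijkl(1) by auto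
  then show ?thesis by (simp add: prod_eq_iff)
qed

text \<open>The color space is identified with the space of functions on the six edges that satisfy the
  vertex relations.  Any such function is matched on two edges at the smallest vertex, and hence
  on all edges.\<close>

lemma color_exists:
  assumes t: "t \<in> tetrahedra" and rel: "vertex_relations \<gamma> t x"
  shows "\<exists>!p. \<forall>e\<in>edges_of t. row_value \<gamma> t e p = x e"
proof (rule ex_ex1I)
  obtain i j k l where ijkl: "vertex_list [i, j, k, l]" "i < j" "j < k" "k < l" "t = {i, j, k, l}"
    using ordered_labels[OF t] by metis
  define D where "D = - \<gamma> i k * tri_det \<gamma> j k l"
  have D: "D \<noteq> 0"
    using coeff_nonzero[of i k] tri_det_nonzero[of j k l] ijkl(1) by (auto simp: D_def)
  define p where "p = (x {i, l} / D, x {i, j} / D)"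
  have "row_value \<gamma> t {i, j} p - x {i, j} = 0" "row_value \<gamma> t {i, l} p - x {i, l} = 0"
    unfolding ijkl(5) ordered_row_values[OF ijkl(1-4)] D_def [symmetric]
    using D by (simp_all add: p_def)
  moreover have t': "t = {i, j, l, k}"
    using ijkl by auto
  ultimately have "row_value \<gamma> t e p - x e = 0" if "e \<in> edges_of t" for e
    using vertex_relations_zero[of i j l k "\<lambda>e. row_value \<gamma> t e p - x e" e]
      vertex_relations_diff[OF vertex_relations_row_value[OF t, of \<gamma> p] rel] that ijkl(1)
    by auto
  then have "\<forall>e\<in>edges_of t. row_value \<gamma> t e p = x e"
    by simp
  then show "\<exists>p. \<forall>e\<in>edges_of t. row_value \<gamma> t e p = x e"
    by blast
next
  fix p q assume pq: "\<forall>e\<in>edges_of t. row_value \<gamma> t e p = x e" "\<forall>e\<in>edges_of t. row_value \<gamma> t e q = x e"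
  obtain a b c d where abcd: "vertex_list [a, b, c, d]" "t = {a, b, c, d}"
    using t by (auto simp: tetrahedron_iff)
  have "row_value \<gamma> t e (p - q) = row_value \<gamma> t e p - row_value \<gamma> t e q" for e
    by (simp add: row_value_def algebra_simps)
  then have "p - q = 0"
    using color_zero[OF abcd(1), of "p - q"] pq abcd by (auto simp: edges_of_tetrahedron)
  then show "p = q" by simp
qed

end

section \<open>Colorings induced by edge weights\<close>

text \<open>With this choice the product of \<open>swap_sign x v\<close> over the vertices \<open>x\<close> of a tetrahedron is the
  sign of that tetrahedron as the facet opposite to \<open>v\<close>.\<close>

definition swap_sign :: "nat \<Rightarrow> nat \<Rightarrow> 'a::field" where
  "swap_sign a b = (if a < b then -1 else 1)"

text \<open>The sign of the permutation sorting \<open>a\<close>, \<open>b\<close>, \<open>c\<close>, \<open>d\<close>.  All six factors are negative in the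
  increasing order, so their product is \<open>1\<close> there.\<close>

definition orientation :: "nat \<Rightarrow> nat \<Rightarrow> nat \<Rightarrow> nat \<Rightarrow> 'a::field" where
  "orientation a b c d = swap_sign a b * swap_sign a c * swap_sign a d * swap_sign b c *
     swap_sign b d * swap_sign c d"

lemma swap_sign_swap: "a \<noteq> b \<Longrightarrow> swap_sign b a = (- swap_sign a b :: 'a::field)"
  by (auto simp: swap_sign_def)

lemma orientation_nonzero: "orientation a b c d \<noteq> 0"
  by (simp add: orientation_def swap_sign_def)

lemma orientation_swap:
  assumes "distinct [a, b, c, d]"
  shows "orientation b a c d = (- orientation a b c d :: 'a::field)"
    and "orientation a c b d = (- orientation a b c d :: 'a::field)"
    and "orientation a b d c = (- orientation a b c d :: 'a::field)"
  using assms by (auto simp: orientation_def swap_sign_swap[of a b] swap_sign_swap[of b c]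
      swap_sign_swap[of c d])

text \<open>How much the triangles \<open>abc\<close> and \<open>abd\<close> disagree about the gauge parameter at \<open>a\<close>.  A labeling
  is chosen here to have a function of the sets \<open>t\<close> and \<open>e\<close>.\<close>

definition edge_value ::
    "(nat \<Rightarrow> nat \<Rightarrow> 'a::field) \<Rightarrow> (nat set \<Rightarrow> 'a) \<Rightarrow> nat set \<Rightarrow> nat set \<Rightarrow> 'a" where
  "edge_value \<gamma> \<psi> t e =
    (let a = Min e; b = Max e; c = Min (t - e); d = Max (t - e)
     in orientation a b c d * (potential \<gamma> \<psi> a b c - potential \<gamma> \<psi> a b d) / \<gamma> a b)"

definition induced_coloring ::
    "(nat \<Rightarrow> nat \<Rightarrow> 'a::field) \<Rightarrow> (nat set \<Rightarrow> 'a) \<Rightarrow> 'a coloring" where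
  "induced_coloring \<gamma> \<psi> t =
    (if t \<in> tetrahedra
     then THE p. \<forall>e\<in>edges_of t. row_value \<gamma> t e p = edge_value \<gamma> \<psi> t e else 0)"

context generic_coefficients
begin

text \<open>The value does not depend on the labeling.  Exchanging \<open>c\<close> and \<open>d\<close> changes the sign of both
  the orientation and the difference of potentials.  For exchanging \<open>a\<close> and \<open>b\<close>: the gauges on \<open>abc\<close> and
  \<open>abd\<close> both produce \<open>\<psi> {a, b}\<close>, so the differences \<open>X\<close> and \<open>Y\<close> at \<open>a\<close> and at \<open>b\<close> satisfy
  \<open>X * \<gamma> b a + Y * \<gamma> a b = 0\<close>.\<close>

lemma edge_value:
  assumes vl: "vertex_list [a, b, c, d]"
  shows "edge_value \<gamma> \<psi> {a, b, c, d} {a, b} =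
    orientation a b c d * (potential \<gamma> \<psi> a b c - potential \<gamma> \<psi> a b d) / \<gamma> a b"
proof -
  let ?f = "\<lambda>a b c d. orientation a b c d * (potential \<gamma> \<psi> a b c - potential \<gamma> \<psi> a b d) / \<gamma> a b"
  have 1: "?f a b d c = ?f a b c d" if "vertex_list [a, b, c, d]" for a b c d
    using that orientation_swap(3)[of a b c d, where 'a = 'a] by (simp add: field_simps)
  have 2: "?f b a c d = ?f a b c d"
  proof -
    define X Y where "X = potential \<gamma> \<psi> a b c - potential \<gamma> \<psi> a b d"
      and "Y = potential \<gamma> \<psi> b a c - potential \<gamma> \<psi> b a d"
    have "\<psi> {a, b} = potential \<gamma> \<psi> a b c * \<gamma> b a + potential \<gamma> \<psi> b a c * \<gamma> a b"
      "\<psi> {a, b} = potential \<gamma> \<psi> a b d * \<gamma> b a + potential \<gamma> \<psi> b a d * \<gamma> a b"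
      by (rule edge_eq_potentials, use vl in auto)+
    then have "X * \<gamma> b a + Y * \<gamma> a b = \<psi> {a, b} - \<psi> {a, b}"
      unfolding X_def Y_def left_diff_distrib by (metis add_diff_add)
    then have "X * \<gamma> b a = - Y * \<gamma> a b"
      by (simp add: eq_neg_iff_add_eq_0)
    then have "X / \<gamma> a b = - Y / \<gamma> b a"
      using coeff_nonzero[of a b] coeff_nonzero[of b a] vl by (subst frac_eq_eq) auto
    moreover have "orientation b a c d = (- orientation a b c d :: 'a)"
      using orientation_swap(1)[of a b c d] vl by blast
    ultimately have "orientation b a c d * (Y / \<gamma> b a) = orientation a b c d * (X / \<gamma> a b)"
      by simp
    then show ?thesis
      by (simp add: X_def Y_def)
  qed
  have diff: "{a, b, c, d} - {a, b} = {c, d}"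
    using vl by auto
  define a' b' c' d' where "a' = min a b" "b' = max a b" "c' = min c d" "d' = max c d"
  note defs = this
  have "edge_value \<gamma> \<psi> {a, b, c, d} {a, b} = ?f a' b' c' d'"
    unfolding edge_value_def diff Let_def by (simp add: defs)
  also have "\<dots> = ?f a' b' c d"
    using 1[of a' b' c d] vl by (auto simp: defs min_def max_def)
  also have "\<dots> = ?f a b c d"
    using 2 vl by (auto simp: defs min_def max_def)
  finally show ?thesis .
qed

text \<open>At the vertex \<open>a\<close> of \<open>abcd\<close> the three potentials \<open>P b c\<close>, \<open>P c d\<close>, \<open>P d b\<close> belong to the three
  triangles at \<open>a\<close>; multiplied by \<open>\<gamma>\<close>, the edge values are, up to a common sign, their successive
  differences, and these have sum zero.\<close>

lemma vertex_relations_edge_value: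
  assumes "t \<in> tetrahedra"
  shows "vertex_relations \<gamma> t (edge_value \<gamma> \<psi> t)"
proof -
  have rel: "\<gamma> a b * edge_value \<gamma> \<psi> t {a, b} + \<gamma> a c * edge_value \<gamma> \<psi> t {a, c}
      + \<gamma> a d * edge_value \<gamma> \<psi> t {a, d} = 0"
    if vl: "vertex_list [a, b, c, d]" and t: "t = {a, b, c, d}" for a b c d
  proof -
    let ?P = "potential \<gamma> \<psi> a" and ?s = "orientation a b c d :: 'a"
    have t': "t = {a, c, b, d}" "t = {a, d, b, c}"
      using t by auto
    have s: "orientation a c b d = - ?s" "orientation a d b c = ?s"
      using orientation_swap(2)[of a b c d, where 'a = 'a]
        orientation_swap(3)[of a b c d, where 'a = 'a]
        orientation_swap(2)[of a b d c, where 'a = 'a] vl by auto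
    have h1: "\<gamma> a b * edge_value \<gamma> \<psi> t {a, b} = ?s * (?P b c - ?P b d)"
      unfolding t using edge_value[of a b c d] coeff_nonzero[of a b] vl by simp
    have h2: "\<gamma> a c * edge_value \<gamma> \<psi> t {a, c} = - ?s * (?P c b - ?P c d)"
      unfolding t'(1) using edge_value[of a c b d] coeff_nonzero[of a c] vl s by auto
    have h3: "\<gamma> a d * edge_value \<gamma> \<psi> t {a, d} = ?s * (?P d b - ?P d c)"
      unfolding t'(2) using edge_value[of a d b c] coeff_nonzero[of a d] vl s by auto
    have "?P c b = ?P b c" "?P d b = ?P b d" "?P d c = ?P c d"
      by (simp_all add: potential_swap)
    then show ?thesis
      unfolding h1 h2 h3 by (simp add: algebra_simps)
  qed
  obtain a b c d where vl: "vertex_list [a, b, c, d]" and t: "t = {a, b, c, d}"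
    using assms by (auto simp: tetrahedron_iff)
  define x where "x = edge_value \<gamma> \<psi> t"
  note rel = rel [folded x_def]
  have "\<gamma> a b * x {a, b} + \<gamma> a c * x {a, c} + \<gamma> a d * x {a, d} = 0"
    by (rule rel) (use vl t in auto)
  moreover have "\<gamma> b a * x {b, a} + \<gamma> b c * x {b, c} + \<gamma> b d * x {b, d} = 0"
    by (rule rel) (use vl t in auto)
  moreover have "\<gamma> c a * x {c, a} + \<gamma> c b * x {c, b} + \<gamma> c d * x {c, d} = 0"
    by (rule rel) (use vl t in auto)
  moreover have "\<gamma> d a * x {d, a} + \<gamma> d b * x {d, b} + \<gamma> d c * x {d, c} = 0"
    by (rule rel) (use vl t in auto)
  ultimately have "vertex_relations \<gamma> {a, b, c, d} x"
    using vl by (simp add: vertex_relations_iff insert_commute)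
  then show ?thesis by (simp add: x_def t)
qed

lemma row_value_induced:
  assumes "t \<in> tetrahedra" "e \<in> edges_of t"
  shows "row_value \<gamma> t e (induced_coloring \<gamma> \<psi> t) = edge_value \<gamma> \<psi> t e"
  using theI'[OF color_exists[OF assms(1) vertex_relations_edge_value[OF assms(1), of \<psi>]]] assms
  by (simp add: induced_coloring_def)

lemma row_value_induced_labeled:
  assumes "vertex_list [a, b, c, d]"
  shows "row_value \<gamma> {a, b, c, d} {a, b} (induced_coloring \<gamma> \<psi> {a, b, c, d}) =
    orientation a b c d * (potential \<gamma> \<psi> a b c - potential \<gamma> \<psi> a b d) / \<gamma> a b"
proof -
  have "{a, b, c, d} \<in> tetrahedra" using assms by (auto simp: tetrahedron_iff)
  then show ?thesis
    using row_value_induced[of "{a, b, c, d}" "{a, b}" \<psi>] edge_value[OF assms, of \<psi>] assms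
    by (auto simp: edges_of_tetrahedron)
qed

lemma induced_coloring_eqI:
  assumes "t \<in> tetrahedra" "\<And>e. e \<in> edges_of t \<Longrightarrow> row_value \<gamma> t e p = edge_value \<gamma> \<psi> t e"
  shows "induced_coloring \<gamma> \<psi> t = p"
  using color_exists[OF assms(1) vertex_relations_edge_value[OF assms(1), of \<psi>]]
    row_value_induced[OF assms(1), of _ \<psi>] assms(2) by blast

lemma edge_value_add:
  "edge_value \<gamma> (\<lambda>e. \<psi> e + \<phi> e) t e = edge_value \<gamma> \<psi> t e + edge_value \<gamma> \<phi> t e"
  unfolding edge_value_def Let_def potential_add add_divide_distrib [symmetric]
  by (simp add: algebra_simps)

lemma edge_value_scale: "edge_value \<gamma> (\<lambda>e. x * \<psi> e) t e = x * edge_value \<gamma> \<psi> t e"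
  unfolding edge_value_def Let_def potential_scale by (simp add: algebra_simps)

lemma induced_coloring_add:
  "induced_coloring \<gamma> (\<lambda>e. \<psi> e + \<phi> e) = induced_coloring \<gamma> \<psi> + induced_coloring \<gamma> \<phi>"
proof
  fix t
  show "induced_coloring \<gamma> (\<lambda>e. \<psi> e + \<phi> e) t = (induced_coloring \<gamma> \<psi> + induced_coloring \<gamma> \<phi>) t"
  proof (cases "t \<in> tetrahedra")
    case True
    then show ?thesis
      by (intro induced_coloring_eqI) (simp_all add: row_value_add row_value_induced edge_value_add)
  qed (simp add: induced_coloring_def)
qed

lemma induced_coloring_scale:
  "induced_coloring \<gamma> (\<lambda>e. x * \<psi> e) = scale_coloring x (induced_coloring \<gamma> \<psi>)"
proof
  fix t
  show "induced_coloring \<gamma> (\<lambda>e. x * \<psi> e) t = scale_coloring x (induced_coloring \<gamma> \<psi>) t"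
  proof (cases "t \<in> tetrahedra")
    case True
    have "row_value \<gamma> t e (scale_coloring x c t) = x * row_value \<gamma> t e (c t)" for e c
      by (simp add: row_value_def scale_coloring_def algebra_simps)
    with True show ?thesis
      by (intro induced_coloring_eqI) (simp_all add: row_value_induced edge_value_scale)
  qed (simp add: induced_coloring_def scale_coloring_def zero_prod_def)
qed

lemma induced_zero_iff:
  assumes "t \<in> tetrahedra"
  shows "induced_coloring \<gamma> \<psi> t = 0 \<longleftrightarrow> (\<forall>a b c d. t = {a, b, c, d} \<longrightarrow> distinct [a, b, c, d] \<longrightarrow>
    potential \<gamma> \<psi> a b c = potential \<gamma> \<psi> a b d)" (is "?L \<longleftrightarrow> ?R")
proof
  assume ?L
  show ?R
  proof (intro allI impI)
    fix a b c d assume t: "t = {a, b, c, d}" and d: "distinct [a, b, c, d]"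
    then have vl: "vertex_list [a, b, c, d]"
      using assms by (auto simp: tetrahedra_def)
    then show "potential \<gamma> \<psi> a b c = potential \<gamma> \<psi> a b d"
      using row_value_induced_labeled[OF vl, of \<psi>] \<open>?L\<close> coeff_nonzero[of a b] orientation_nonzero[of a b c d]
      unfolding t by (auto simp: row_value_def)
  qed
next
  assume R: ?R
  obtain a b c d where vl: "vertex_list [a, b, c, d]" and t: "t = {a, b, c, d}"
    using assms by (auto simp: tetrahedron_iff)
  have t': "{a, b, c, d} = {a, c, b, d}" by auto
  have "potential \<gamma> \<psi> a b c = potential \<gamma> \<psi> a b d" "potential \<gamma> \<psi> a c b = potential \<gamma> \<psi> a c d"
    using R vl t t' by auto
  then show ?L
    unfolding t using row_value_induced_labeled[of a b c d \<psi>] row_value_induced_labeled[of a c b d \<psi>] vl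
    by (intro color_zero[OF vl]) (auto simp: t'[symmetric])
qed

lemma induced_coloring_diff:
  "induced_coloring \<gamma> (\<lambda>e. \<psi> e - \<phi> e) = induced_coloring \<gamma> \<psi> - induced_coloring \<gamma> \<phi>"
  using induced_coloring_add[of "\<lambda>e. \<psi> e - \<phi> e" \<phi>] by (simp add: algebra_simps)

text \<open>Any two triangles of a tetrahedron that contain \<open>a\<close> share an edge at \<open>a\<close>, and comparing them
  across this edge shows that they have the same potential at \<open>a\<close>.\<close>

lemma induced_zero_imp_constant:
  assumes t: "t \<in> tetrahedra" and zero: "induced_coloring \<gamma> \<psi> t = 0"
  shows "\<exists>l. \<forall>a b c. distinct [a, b, c] \<longrightarrow> {a, b, c} \<subseteq> t \<longrightarrow> potential \<gamma> \<psi> a b c = l a"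
proof -
  have step: "potential \<gamma> \<psi> a b c = potential \<gamma> \<psi> a b d"
    if "t = {a, b, c, d}" "distinct [a, b, c, d]" for a b c d
    using induced_zero_iff[OF t] zero that by blast
  have const: "potential \<gamma> \<psi> a b c = potential \<gamma> \<psi> a b' c'"
    if "distinct [a, b, c]" "{a, b, c} \<subseteq> t" "distinct [a, b', c']" "{a, b', c'} \<subseteq> t" for a b c b' c'
  proof -
    have "card (t - {a, b, c}) = 1"
      using t that by (subst card_Diff_subset) (auto simp: tetrahedra_def)
    then obtain d where "t - {a, b, c} = {d}" by (auto simp: card_1_singleton_iff)
    with that have d: "t = {a, b, c, d}" "distinct [a, b, c, d]" by auto
    have 1: "potential \<gamma> \<psi> a b c = potential \<gamma> \<psi> a b d" using step d by blast
    have "t = {a, c, b, d}" "distinct [a, c, b, d]" using d by auto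
    from step[OF this] have 2: "potential \<gamma> \<psi> a b c = potential \<gamma> \<psi> a c d"
      by (simp add: potential_swap)
    have "b' \<in> {b, c, d}" "c' \<in> {b, c, d}" "b' \<noteq> c'" using that d by auto
    then show ?thesis
      using 1 2 potential_swap[of \<gamma> \<psi> a] by (elim insertE emptyE) simp_all
  qed
  define l where "l a = (SOME x. \<exists>b c. distinct [a, b, c] \<and> {a, b, c} \<subseteq> t \<and> x = potential \<gamma> \<psi> a b c)" for a
  have "potential \<gamma> \<psi> a b c = l a" if abc: "distinct [a, b, c]" "{a, b, c} \<subseteq> t" for a b c
  proof -
    have "\<exists>b c. distinct [a, b, c] \<and> {a, b, c} \<subseteq> t \<and> l a = potential \<gamma> \<psi> a b c"
      unfolding l_def by (rule someI_ex) (use abc in blast)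
    then show ?thesis using const abc by metis
  qed
  then show ?thesis by blast
qed

lemma induced_gauge: "induced_coloring \<gamma> (gauge \<gamma> l) = 0"
proof
  fix t show "induced_coloring \<gamma> (gauge \<gamma> l) t = 0 t"
  proof (cases "t \<in> tetrahedra")
    case True
    have "induced_coloring \<gamma> (gauge \<gamma> l) t = 0"
      unfolding induced_zero_iff[OF True]
    proof (intro allI impI)
      fix a b c d assume "t = {a, b, c, d}" "distinct [a, b, c, d]"
      with True have vl: "vertex_list [a, b, c]" "vertex_list [a, b, d]"
        by (auto simp: tetrahedra_def)
      have "potential \<gamma> (gauge \<gamma> l) a b c = l a" "potential \<gamma> (gauge \<gamma> l) a b d = l a"
        by (rule potential_of_gauge; use vl in \<open>simp add: gauge_edge\<close>)+
      then show "potential \<gamma> (gauge \<gamma> l) a b c = potential \<gamma> (gauge \<gamma> l) a b d" by simp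
    qed
    then show ?thesis by simp
  qed (simp add: induced_coloring_def)
qed

lemma induced_diff_gauge:
  "induced_coloring \<gamma> (\<lambda>e. \<psi> e - gauge \<gamma> l e) = induced_coloring \<gamma> \<psi>"
  by (simp add: induced_coloring_diff induced_gauge)

text \<open>By linearity, this makes the induced color of a tetrahedron depend only on the weights of its
  own edges.\<close>

lemma induced_zero:
  assumes "\<And>e. e \<in> edges_of t \<Longrightarrow> \<psi> e = 0"
  shows "induced_coloring \<gamma> \<psi> t = 0"
proof (cases "t \<in> tetrahedra")
  case True
  show ?thesis
    unfolding induced_zero_iff[OF True]
  proof (intro allI impI)
    fix a b c d assume t: "t = {a, b, c, d}" "distinct [a, b, c, d]"
    have "potential \<gamma> \<psi> a b c = 0" "potential \<gamma> \<psi> a b d = 0"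
      by (rule potential_zero; rule assms; use t in \<open>simp add: edges_of_tetrahedron\<close>)+
    then show "potential \<gamma> \<psi> a b c = potential \<gamma> \<psi> a b d" by simp
  qed
qed (simp add: induced_coloring_def)

lemma induced_cong:
  assumes "\<And>e. e \<in> edges_of t \<Longrightarrow> \<psi> e = \<phi> e"
  shows "induced_coloring \<gamma> \<psi> t = induced_coloring \<gamma> \<phi> t"
  using induced_zero[of t "\<lambda>e. \<psi> e - \<phi> e"] assms by (simp add: induced_coloring_diff)

text \<open>On each of the tetrahedra in question \<open>\<psi>\<close> is a gauge with parameters \<open>L x y\<close>.  Passing from
  \<open>(x, y)\<close> to another pair one index at a time, consecutive tetrahedra share a triangle, so
  the parameter at \<open>a\<close> is preserved as long as no index equals \<open>a\<close>.  Any two pairs avoiding \<open>a\<close>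
  are connected in this way by at most two steps.  For \<open>X = omitted C\<close> and \<open>Y\<close> its complement this concerns
  the whole boundary of \<open>C\<close>; for a singleton \<open>X\<close>, the intersection of one pentachoron with
  several others.\<close>

lemma common_gauge:
  assumes XY: "X \<subseteq> vertices" "Y \<subseteq> vertices" "X \<inter> Y = {}"
    and zero: "\<And>x y. x \<in> X \<Longrightarrow> y \<in> Y \<Longrightarrow> induced_coloring \<gamma> \<psi> (vertices - {x, y}) = 0"
  shows "\<exists>l. \<forall>x\<in>X. \<forall>y\<in>Y. \<forall>e\<in>edges_of (vertices - {x, y}). \<psi> e = gauge \<gamma> l e"
proof -
  let ?t = "\<lambda>x y. vertices - {x, y}"
  define P where "P x y l \<longleftrightarrow>
    (\<forall>a b c. distinct [a, b, c] \<longrightarrow> {a, b, c} \<subseteq> ?t x y \<longrightarrow> potential \<gamma> \<psi> a b c = l a)" for x y l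
  have "\<forall>x\<in>X. \<forall>y\<in>Y. \<exists>l. P x y l"
  proof (intro ballI)
    fix x y assume xy: "x \<in> X" "y \<in> Y"
    with XY have "?t x y \<in> tetrahedra"
      by (intro tetrahedron_label) auto
    from induced_zero_imp_constant[OF this zero[OF xy]] show "\<exists>l. P x y l"
      unfolding P_def .
  qed
  then obtain L where L: "\<forall>x\<in>X. \<forall>y\<in>Y. P x y (L x y)" by metis
  have LP: "L x y a = potential \<gamma> \<psi> a b c"
    if "x \<in> X" "y \<in> Y" "distinct [a, b, c]" "{a, b, c} \<subseteq> ?t x y" for x y a b c
    using L that unfolding P_def by metis
  \<comment> \<open>Outside three indices and \<open>a\<close>, two of the six vertices are left to form a triangle with \<open>a\<close>.\<close>
  have two: "\<exists>b c. distinct [a, b, c] \<and> b \<notin> S \<and> c \<notin> S \<and> {b, c} \<subseteq> vertices"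
    if "card S \<le> 3" "finite S" for a :: nat and S
  proof -
    have "card (vertices - insert a S) \<ge> 2"
      using that diff_card_le_card_Diff[of "insert a S" vertices]
      by (auto simp: vertices_def card_insert_if split: if_splits)
    then obtain B where "B \<subseteq> vertices - insert a S" "card B = 2"
      by (meson obtain_subset_with_card_n)
    then show ?thesis by (auto simp: card_2_iff)
  qed
  have move: "L x y a = L x' y' a"
    if xy: "x \<in> X" "y \<in> Y" "x' \<in> X" "y' \<in> Y" "x = x' \<or> y = y'" and a: "a \<in> vertices - {x, x', y, y'}"
    for x x' y y' a
  proof -
    have "card {x, x', y, y'} \<le> 3"
      using xy(5) by (auto simp: card_insert_if)
    from two[OF this, of a] obtain b c
      where "distinct [a, b, c]" "b \<notin> {x, x', y, y'}" "c \<notin> {x, x', y, y'}" "{b, c} \<subseteq> vertices"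
      by auto
    then have "L x y a = potential \<gamma> \<psi> a b c" "L x' y' a = potential \<gamma> \<psi> a b c"
      by (rule_tac LP; use xy a in auto)+
    then show ?thesis by simp
  qed
  define x0 where "x0 a = (SOME x. x \<in> X - {a})" for a
  define y0 where "y0 a = (SOME y. y \<in> Y - {a})" for a
  define l where "l a = L (x0 a) (y0 a) a" for a
  have l: "l a = L x y a" if "x \<in> X" "y \<in> Y" "a \<in> vertices - {x, y}" for x y a
  proof -
    have "x0 a \<in> X - {a}" "y0 a \<in> Y - {a}"
      unfolding x0_def y0_def by (rule someI_ex; use that in auto)+
    then have "L (x0 a) (y0 a) a = L x (y0 a) a" "L x (y0 a) a = L x y a"
      using that by (auto intro!: move)
    then show ?thesis by (simp add: l_def)
  qed
  have "\<psi> e = gauge \<gamma> l e" if xy: "x \<in> X" "y \<in> Y" and e: "e \<in> edges_of (?t x y)" for x y e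
  proof -
    obtain i j where ij: "e = {i, j}" "i \<noteq> j"
      using e by (auto simp: edges_of_def card_2_iff)
    have "card {x, y, j} \<le> 3" by (simp add: card_insert_if)
    then obtain c where "c \<in> vertices - {x, y, i, j}"
      using two[of "{x, y, j}" i] by auto
    with e ij have vl: "vertex_list [i, j, c]" and sub: "{i, j, c} \<subseteq> ?t x y"
      by (auto simp: edges_of_def)
    have "L x y i = potential \<gamma> \<psi> i j c" "L x y j = potential \<gamma> \<psi> j i c"
      by (rule LP; use xy vl sub in auto)+
    moreover have "l i = L x y i" "l j = L x y j"
      using l[OF xy] sub by auto
    ultimately show ?thesis
      using edge_eq_potentials[OF vl, of \<psi>] ij by (simp add: gauge_edge)
  qed
  then show ?thesis by blast
qed

text \<open>An edge misses a vertex of the triangle \<open>123\<close> and a vertex of the triangle \<open>456\<close>, so every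
  edge is covered by the tetrahedra that omit one vertex of each.\<close>

lemma global_gauge:
  assumes "\<And>t. t \<in> tetrahedra \<Longrightarrow> induced_coloring \<gamma> \<psi> t = 0"
  shows "\<exists>l. \<forall>e\<in>edges_of vertices. \<psi> e = gauge \<gamma> l e"
proof -
  have "\<exists>l. \<forall>x\<in>{1, 2, 3}. \<forall>y\<in>{4, 5, 6}. \<forall>e\<in>edges_of (vertices - {x, y}). \<psi> e = gauge \<gamma> l e"
  proof (rule common_gauge)
    fix x y :: nat assume "x \<in> {1, 2, 3}" "y \<in> {4, 5, 6}"
    then have "vertex_list [x, y]" by (auto simp: vertices_eq)
    then show "induced_coloring \<gamma> \<psi> (vertices - {x, y}) = 0"
      using assms tetrahedron_label by blast
  qed (auto simp: vertices_eq)
  then obtain l where l: "\<And>x y e. x \<in> {1, 2, 3} \<Longrightarrow> y \<in> {4, 5, 6} \<Longrightarrow> e \<in> edges_of (vertices - {x, y}) \<Longrightarrow>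
      \<psi> e = gauge \<gamma> l e"
    by metis
  have "\<psi> e = gauge \<gamma> l e" if e: "e \<in> edges_of vertices" for e
  proof -
    have fin: "finite e" "card e = 2"
      using e by (auto simp: edges_of_def intro: card_ge_0_finite)
    have "\<exists>x. x \<in> X \<and> x \<notin> e" if "card X = 3" for X
      using that fin card_mono[of e X] by fastforce
    from this[of "{1, 2, 3}"] this[of "{4, 5, 6}"] obtain x y
      where "x \<in> {1, 2, 3}" "x \<notin> e" "y \<in> {4, 5, 6}" "y \<notin> e" by auto
    then show ?thesis
      using l[of x y e] e by (auto simp: edges_of_def)
  qed
  then show ?thesis by blast
qed

end

section \<open>Induced colorings are permitted\<close>

lemma prod_swap_sign:
  "finite t \<Longrightarrow> (\<Prod>x\<in>t. swap_sign x v) = (- 1 :: 'a::field) ^ card {x \<in> t. x < v}"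
proof (induction t rule: finite_induct)
  case (insert x t)
  have "{y \<in> insert x t. y < v} = (if x < v then insert x {y \<in> t. y < v} else {y \<in> t. y < v})"
    by auto
  with insert show ?case by (simp add: swap_sign_def)
qed simp

text \<open>The vertex \<open>v\<close> is the one missing in the facet, and the facet sign counts the other vertices
  preceding it.\<close>

lemma facet_sign_eq:
  assumes "distinct [a, b, c, d, v]"
  shows "of_int (facet_sign 1 {a, b, c, d, v} {a, b, c, d}) =
    (swap_sign a v * swap_sign b v * swap_sign c v * swap_sign d v :: 'a::field)"
proof -
  have diff: "{a, b, c, d, v} - {a, b, c, d} = {v}"
    using assms by auto
  have less: "{w \<in> {a, b, c, d, v}. w < v} = {w \<in> {a, b, c, d}. w < v}"
    by auto
  show ?thesis
    unfolding facet_sign_def diff the_elem_eq less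
    using prod_swap_sign[of "{a, b, c, d}" v, where 'a = 'a] assms by (simp add: mult.assoc)
qed

text \<open>The tetrahedra of a pentachoron that contain \<open>ab\<close> omit one of the other three vertices.\<close>

lemma edge_functional_expand:
  fixes \<gamma> :: "nat \<Rightarrow> nat \<Rightarrow> 'a::field"
  assumes vl: "vertex_list [a, b, c, d, v]"
  shows "edge_functional \<gamma> 1 {a, b, c, d, v} {a, b} k =
    swap_sign a v * swap_sign b v * swap_sign c v * swap_sign d v *
      row_value \<gamma> {a, b, c, d} {a, b} (k {a, b, c, d}) +
    swap_sign a d * swap_sign b d * swap_sign c d * swap_sign v d *
      row_value \<gamma> {a, b, c, v} {a, b} (k {a, b, c, v}) +
    swap_sign a c * swap_sign b c * swap_sign d c * swap_sign v c *
      row_value \<gamma> {a, b, d, v} {a, b} (k {a, b, d, v})"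
proof -
  let ?u = "{a, b, c, d, v}"
  have tets: "{t. t \<in> tetrahedra \<and> {a, b} \<subseteq> t \<and> t \<subseteq> ?u} = {{a, b, c, d}, {a, b, c, v}, {a, b, d, v}}"
  proof (intro equalityI subsetI)
    fix t assume "t \<in> {t. t \<in> tetrahedra \<and> {a, b} \<subseteq> t \<and> t \<subseteq> ?u}"
    then have t: "card t = 4" "{a, b} \<subseteq> t" "t \<subseteq> ?u" by (auto simp: tetrahedra_def)
    have "card (?u - t) = 1"
      using t vl by (subst card_Diff_subset) (auto intro: finite_subset)
    then obtain x where x: "?u - t = {x}" by (auto simp: card_1_singleton_iff)
    then have "x \<in> ?u - t" by simp
    then have "x = c \<or> x = d \<or> x = v" using t by auto
    moreover have "t = ?u - {x}" using x t by blast
    ultimately show "t \<in> {{a, b, c, d}, {a, b, c, v}, {a, b, d, v}}"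
      using vl by auto
  next
    fix t assume "t \<in> {{a, b, c, d}, {a, b, c, v}, {a, b, d, v}}"
    then show "t \<in> {t. t \<in> tetrahedra \<and> {a, b} \<subseteq> t \<and> t \<subseteq> ?u}"
      using vl by (auto simp: tetrahedra_def)
  qed
  have neq: "{a, b, c, d} \<noteq> {a, b, c, v}" "{a, b, c, d} \<noteq> {a, b, d, v}" "{a, b, c, v} \<noteq> {a, b, d, v}"
    using vl by auto
  have perm: "{a, b, c, v, d} = ?u" "{a, b, d, v, c} = ?u" by auto
  have sign: "of_int (facet_sign 1 ?u {a, b, c, d}) =
      (swap_sign a v * swap_sign b v * swap_sign c v * swap_sign d v :: 'a)"
    "of_int (facet_sign 1 ?u {a, b, c, v}) =
      (swap_sign a d * swap_sign b d * swap_sign c d * swap_sign v d :: 'a)"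
    "of_int (facet_sign 1 ?u {a, b, d, v}) =
      (swap_sign a c * swap_sign b c * swap_sign d c * swap_sign v c :: 'a)"
    using facet_sign_eq[of a b c d v, where 'a = 'a]
      facet_sign_eq[of a b c v d, where 'a = 'a, unfolded perm]
      facet_sign_eq[of a b d v c, where 'a = 'a, unfolded perm] vl by auto
  show ?thesis
    unfolding edge_functional_def tets using neq by (simp add: sign row_value_def add.assoc)
qed

lemma edge_functional_diff:
  "edge_functional \<gamma> s u e (k - k') = edge_functional \<gamma> s u e k - edge_functional \<gamma> s u e k'"
  by (simp add: edge_functional_def sum_subtractf [symmetric] algebra_simps)

lemma edge_functional_add:
  "edge_functional \<gamma> s u e (k + k') = edge_functional \<gamma> s u e k + edge_functional \<gamma> s u e k'"
  by (simp add: edge_functional_def sum.distrib [symmetric] algebra_simps)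

lemma edge_functional_scale:
  "edge_functional \<gamma> s u e (scale_coloring x k) = x * edge_functional \<gamma> s u e k"
  by (simp add: edge_functional_def sum_distrib_left scale_coloring_def algebra_simps)

lemma edge_functional_cong:
  assumes "\<And>t. t \<in> tetrahedra \<Longrightarrow> t \<subseteq> u \<Longrightarrow> k t = k' t"
  shows "edge_functional \<gamma> s u e k = edge_functional \<gamma> s u e k'"
  unfolding edge_functional_def using assms by (intro sum.cong) auto

lemma subspace_permitted: "coloring.subspace (permitted \<gamma> C)"
  unfolding coloring.subspace_def
proof (intro conjI ballI allI)
  have "edge_functional \<gamma> 1 u e 0 = 0" for u e
    by (simp add: edge_functional_def)
  then show "0 \<in> permitted \<gamma> C"
    by (simp add: permitted_def colorings_def)
qed (auto simp: permitted_def colorings_def edge_functional_add edge_functional_scale,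
  auto simp: scale_coloring_def zero_prod_def)

context generic_coefficients
begin

text \<open>Each facet sign times the orientation of the facet is, up to the sign of a permutation, the
  orientation of the whole pentachoron.  Therefore the three terms are the cyclic differences of the
  potentials at \<open>a\<close> of the triangles \<open>abc\<close>, \<open>abd\<close>, \<open>abv\<close>, with a common factor.\<close>

lemma edge_functional_induced:
  assumes "u \<in> pentachora" "e \<in> edges_of u"
  shows "edge_functional \<gamma> 1 u e (induced_coloring \<gamma> \<psi>) = 0"
proof -
  obtain a b c d v where vl: "vertex_list [a, b, c, d, v]" and u: "u = {a, b, c, d, v}" "e = {a, b}"
    using pentachoron_edge_labels[OF assms] by metis
  let ?P = "potential \<gamma> \<psi> a b" and ?s = "swap_sign :: nat \<Rightarrow> nat \<Rightarrow> 'a"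
  define S where "S = orientation a b c d * (?s a v * ?s b v * ?s c v * ?s d v)"
  have "?s a d * ?s b d * ?s c d * ?s v d * orientation a b c v = - S"
    using swap_sign_swap[of d v, where 'a = 'a] vl by (simp add: S_def orientation_def)
  moreover have "?s a c * ?s b c * ?s d c * ?s v c * orientation a b d v = S"
    using swap_sign_swap[of c d, where 'a = 'a] swap_sign_swap[of c v, where 'a = 'a] vl
    by (simp add: S_def orientation_def)
  moreover have "?s a v * ?s b v * ?s c v * ?s d v * orientation a b c d = S"
    by (simp add: S_def)
  moreover have "edge_functional \<gamma> 1 u e (induced_coloring \<gamma> \<psi>) =
    (?s a v * ?s b v * ?s c v * ?s d v * orientation a b c d) * ((?P c - ?P d) / \<gamma> a b) +
    (?s a d * ?s b d * ?s c d * ?s v d * orientation a b c v) * ((?P c - ?P v) / \<gamma> a b) +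
    (?s a c * ?s b c * ?s d c * ?s v c * orientation a b d v) * ((?P d - ?P v) / \<gamma> a b)"
    unfolding u edge_functional_expand[OF vl]
    using vl by (simp add: row_value_induced_labeled mult.assoc)
  ultimately have "edge_functional \<gamma> 1 u e (induced_coloring \<gamma> \<psi>) =
    S * ((?P c - ?P d) / \<gamma> a b) + - S * ((?P c - ?P v) / \<gamma> a b) + S * ((?P d - ?P v) / \<gamma> a b)"
    by simp
  also have "\<dots> = 0"
    by (simp add: diff_divide_distrib algebra_simps)
  finally show ?thesis .
qed

end

section \<open>Permitted colorings are induced\<close>

context generic_coefficients
begin

text \<open>The weight of \<open>bd\<close> enters the potential at \<open>a\<close> of the triangle \<open>abd\<close> only, and with nonzero
  coefficient.  It controls the value on \<open>ab\<close>, where \<open>abc\<close> and \<open>abd\<close> are compared, and leaves the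
  value on \<open>ac\<close> alone, where \<open>abc\<close> and \<open>acd\<close> are compared.\<close>

lemma adjust_edge:
  assumes vl: "vertex_list [a, b, c, d]"
  shows "\<exists>x. row_value \<gamma> {a, b, c, d} {a, b} (induced_coloring \<gamma> (\<lambda>e. if e = {b, d} then x else 0) {a, b, c, d}) = q \<and>
     row_value \<gamma> {a, b, c, d} {a, c} (induced_coloring \<gamma> (\<lambda>e. if e = {b, d} then x else 0) {a, b, c, d}) = 0"
proof -
  \<comment> \<open>The weight solves \<open>orientation a b c d * \<gamma> a d * x / tri_det \<gamma> a b d = q\<close>.\<close>
  define x where "x = q * tri_det \<gamma> a b d / (orientation a b c d * \<gamma> a d)"
  let ?\<psi> = "\<lambda>e. if e = {b, d} then x else 0"
  have vl': "vertex_list [a, c, b, d]" and t: "{a, b, c, d} = {a, c, b, d}" using vl by auto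
  have "potential \<gamma> ?\<psi> a b c = 0" "potential \<gamma> ?\<psi> a c b = 0" "potential \<gamma> ?\<psi> a c d = 0"
    by (rule potential_zero; use vl in \<open>simp add: doubleton_eq_iff\<close>)+
  moreover have "potential \<gamma> ?\<psi> a b d = - \<gamma> a b * \<gamma> a d * x / tri_det \<gamma> a b d"
    using vl by (simp add: potential_def doubleton_eq_iff)
  ultimately show ?thesis
    using vl coeff_nonzero[of a b] coeff_nonzero[of a d] tri_det_nonzero[of a b d]
      orientation_nonzero[of a b c d, where 'a = 'a]
      row_value_induced_labeled[OF vl, of ?\<psi>] row_value_induced_labeled[OF vl', of ?\<psi>]
    by (intro exI[of _ x]) (simp add: x_def t[symmetric])
qed

text \<open>Only three tetrahedra contribute to the functional of \<open>ab\<close>; if two of them have color zero, the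
  third contribution vanishes separately.\<close>

lemma row_value_zero_of_functional:
  assumes vl: "vertex_list [a, b, c, d, v]"
    and f: "\<And>e. e \<in> edges_of {a, b, c, d, v} \<Longrightarrow> edge_functional \<gamma> 1 {a, b, c, d, v} e k = 0"
    and "k {a, b, c, d} = 0" "k {a, b, c, v} = 0"
  shows "row_value \<gamma> {a, b, d, v} {a, b} (k {a, b, d, v}) = 0"
proof -
  have "{a, b} \<in> edges_of {a, b, c, d, v}"
    using vl by (auto simp: edges_of_def)
  from f[OF this] show ?thesis
    unfolding edge_functional_expand[OF vl] using assms(3,4)
    by (simp add: row_value_def swap_sign_def split: if_splits)
qed

text \<open>The weights of \<open>bd\<close> and \<open>cd\<close> realize the color of \<open>abcd\<close>, those of \<open>bv\<close> and \<open>cv\<close> the color of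
  \<open>abcv\<close>, and that of \<open>dv\<close> one of the two coordinates of the color of \<open>abdv\<close>.  After subtracting the induced
  coloring, the edge functionals propagate zero to the other coordinate and to the remaining two
  tetrahedra.\<close>

lemma pentachoron_exact:
  assumes vl: "vertex_list [a, b, c, d, v]"
    and f: "\<And>e. e \<in> edges_of {a, b, c, d, v} \<Longrightarrow> edge_functional \<gamma> 1 {a, b, c, d, v} e k = 0"
  shows "\<exists>\<psi>. \<forall>t\<in>tetrahedra. t \<subseteq> {a, b, c, d, v} \<longrightarrow> k t = induced_coloring \<gamma> \<psi> t"
proof -
  let ?I = "induced_coloring \<gamma>"
  let ?w = "\<lambda>i j x e. if e = {i, j} then x else (0 :: 'a)"
  let ?u = "{a, b, c, d, v}" and ?t1 = "{a, b, c, d}" and ?t2 = "{a, b, c, v}" and ?t3 = "{a, b, d, v}"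
    and ?t4 = "{a, c, d, v}" and ?t5 = "{b, c, d, v}"
  have perm: "{a, c, b, d} = ?t1" "{a, c, b, v} = ?t2" "{a, d, b, v} = ?t3"
    by auto
  obtain x1 where x1: "row_value \<gamma> ?t1 {a, b} (?I (?w b d x1) ?t1) = row_value \<gamma> ?t1 {a, b} (k ?t1)"
      "row_value \<gamma> ?t1 {a, c} (?I (?w b d x1) ?t1) = 0"
    using adjust_edge[of a b c d "row_value \<gamma> ?t1 {a, b} (k ?t1)"] vl by auto
  obtain x2 where x2: "row_value \<gamma> ?t1 {a, c} (?I (?w c d x2) ?t1) = row_value \<gamma> ?t1 {a, c} (k ?t1)"
      "row_value \<gamma> ?t1 {a, b} (?I (?w c d x2) ?t1) = 0"
    using adjust_edge[of a c b d "row_value \<gamma> ?t1 {a, c} (k ?t1)", unfolded perm] vl by auto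
  obtain x3 where x3: "row_value \<gamma> ?t2 {a, b} (?I (?w b v x3) ?t2) = row_value \<gamma> ?t2 {a, b} (k ?t2)"
      "row_value \<gamma> ?t2 {a, c} (?I (?w b v x3) ?t2) = 0"
    using adjust_edge[of a b c v "row_value \<gamma> ?t2 {a, b} (k ?t2)"] vl by auto
  obtain x4 where x4: "row_value \<gamma> ?t2 {a, c} (?I (?w c v x4) ?t2) = row_value \<gamma> ?t2 {a, c} (k ?t2)"
      "row_value \<gamma> ?t2 {a, b} (?I (?w c v x4) ?t2) = 0"
    using adjust_edge[of a c b v "row_value \<gamma> ?t2 {a, c} (k ?t2)", unfolded perm] vl by auto
  \<comment> \<open>The weights \<open>x2\<close> and \<open>x4\<close> belong to edges at \<open>c\<close> and do not affect \<open>abdv\<close>.\<close>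
  define q where "q = row_value \<gamma> ?t3 {a, d} (k ?t3 - ?I (?w b d x1) ?t3 - ?I (?w b v x3) ?t3)"
  obtain x5 where x5: "row_value \<gamma> ?t3 {a, d} (?I (?w d v x5) ?t3) = q"
    using adjust_edge[of a d b v q, unfolded perm] vl by auto
  define \<psi> where "\<psi> = (\<lambda>e. (?w b d x1 e + ?w c d x2 e) + (?w b v x3 e + ?w c v x4 e) + ?w d v x5 e)"
  define k' where "k' = k - ?I \<psi>"
  have k': "k' t = k t - ((?I (?w b d x1) t + ?I (?w c d x2) t) +
      (?I (?w b v x3) t + ?I (?w c v x4) t) + ?I (?w d v x5) t)" for t
    unfolding k'_def \<psi>_def induced_coloring_add by simp
  have "?I (?w i j x) t = 0" if "i \<notin> t \<or> j \<notin> t" for i j x t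
    by (rule induced_zero) (use that in \<open>auto simp: edges_of_def\<close>)
  then have away: "?I (?w i v x) ?t1 = 0" "?I (?w i d x) ?t2 = 0" "?I (?w d i x) ?t2 = 0"
    "?I (?w c i x) ?t3 = 0" for i x
    using vl by auto
  have f': "edge_functional \<gamma> 1 ?u e k' = 0" if "e \<in> edges_of ?u" for e
  proof -
    have "?u \<in> pentachora"
      using vl by (auto simp: pentachora_def)
    then show ?thesis
      using f edge_functional_induced that by (simp add: k'_def edge_functional_diff)
  qed
  have t1: "k' ?t1 = 0"
    by (rule color_zero[of a b c d]) (use vl x1 x2 in \<open>simp_all add: k' away row_value_diff row_value_add\<close>)
  have t2: "k' ?t2 = 0"
    by (rule color_zero[of a b c v]) (use vl x3 x4 in \<open>simp_all add: k' away row_value_diff row_value_add\<close>)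
  have t3: "k' ?t3 = 0"
  proof -
    have "row_value \<gamma> ?t3 {a, d} (k' ?t3) = 0"
      using vl x5 by (simp add: q_def k' away row_value_diff row_value_add)
    moreover have "row_value \<gamma> ?t3 {a, b} (k' ?t3) = 0"
      by (rule row_value_zero_of_functional[of a b c d v]) (use vl f' t1 t2 in simp_all)
    ultimately show ?thesis
      using color_zero[of a b d v "k' ?t3"] vl by simp
  qed
  have t4: "k' ?t4 = 0"
  proof -
    have "?u = {a, c, b, d, v}" "?u = {a, d, b, c, v}" by auto
    note f4 = f'[unfolded this(1)] f'[unfolded this(2)]
    have "{a, d, b, c} = ?t1" "{a, d, c, v} = ?t4" by auto
    note perm4 = perm this
    have "row_value \<gamma> ?t4 {a, c} (k' ?t4) = 0"
      by (rule row_value_zero_of_functional[of a c b d v])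
        (use vl f4(1) t1 t2 in \<open>auto simp: perm4\<close>)
    moreover have "row_value \<gamma> ?t4 {a, d} (k' ?t4) = 0"
      by (rule row_value_zero_of_functional[of a d b c v, unfolded perm4])
        (use vl f4(2) t1 t3 in \<open>auto simp: perm4\<close>)
    ultimately show ?thesis
      using color_zero[of a c d v "k' ?t4"] vl by simp
  qed
  have t5: "k' ?t5 = 0"
  proof -
    have "?u = {b, c, a, d, v}" "?u = {b, d, a, c, v}" by auto
    note f5 = f'[unfolded this(1)] f'[unfolded this(2)]
    have "{b, c, a, d} = ?t1" "{b, c, a, v} = ?t2" "{b, d, a, c} = ?t1" "{b, d, a, v} = ?t3"
      "{b, d, c, v} = ?t5" by auto
    note perm5 = this
    have "row_value \<gamma> ?t5 {b, c} (k' ?t5) = 0"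
      by (rule row_value_zero_of_functional[of b c a d v])
        (use vl f5(1) t1 t2 in \<open>auto simp: perm5\<close>)
    moreover have "row_value \<gamma> ?t5 {b, d} (k' ?t5) = 0"
      by (rule row_value_zero_of_functional[of b d a c v, unfolded perm5])
        (use vl f5(2) t1 t3 in \<open>auto simp: perm5\<close>)
    ultimately show ?thesis
      using color_zero[of b c d v "k' ?t5"] vl by simp
  qed
  have "k t = ?I \<psi> t" if "t \<in> tetrahedra" "t \<subseteq> ?u" for t
  proof -
    have "k' t = 0"
      using tetrahedra_of_pentachoron[OF that] vl t1 t2 t3 t4 t5 by auto
    then show ?thesis by (simp add: k'_def)
  qed
  then show ?thesis by blast
qed

text \<open>Pentachora are added one at a time.  When \<open>u\<close> is added, a coloring induced by earlier weights is
  subtracted, and the remaining coloring vanishes on the tetrahedra of \<open>C\<close>.  On \<open>u\<close> it is induced by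
  some \<open>\<psi>'\<close>, which is a gauge on every tetrahedron that \<open>u\<close> shares with \<open>C\<close>, with common
  parameters by \<open>common_gauge\<close>.  Subtracting this gauge makes \<open>\<psi>'\<close> zero on all edges that \<open>u\<close> shares with
  \<open>C\<close>, so it can be extended by zero outside \<open>u\<close> without affecting \<open>C\<close>.\<close>

lemma permitted_imp_induced:
  assumes "finite C" "C \<subseteq> pentachora"
    and "\<And>u e. u \<in> C \<Longrightarrow> e \<in> edges_of u \<Longrightarrow> edge_functional \<gamma> 1 u e k = 0"
  shows "\<exists>\<psi>. \<forall>t\<in>tets_of C. k t = induced_coloring \<gamma> \<psi> t"
  using assms
proof (induction C rule: finite_induct)
  case empty
  then show ?case by (simp add: tets_of_def)
next
  case (insert u C)
  then obtain \<psi> where \<psi>: "\<forall>t\<in>tets_of C. k t = induced_coloring \<gamma> \<psi> t"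
    by auto
  have u: "u \<in> pentachora" and C: "C \<subseteq> pentachora"
    using insert.prems by auto
  define k' where "k' = k - induced_coloring \<gamma> \<psi>"
  have k'_C: "k' t = 0" if "t \<in> tets_of C" for t
    using \<psi> that by (simp add: k'_def)
  have k'_u: "edge_functional \<gamma> 1 u e k' = 0" if "e \<in> edges_of u" for e
    using insert.prems(2) edge_functional_induced[OF u that] that
    by (simp add: k'_def edge_functional_diff)
  obtain \<psi>' where \<psi>': "\<forall>t\<in>tetrahedra. t \<subseteq> u \<longrightarrow> k' t = induced_coloring \<gamma> \<psi>' t"
  proof -
    have "card u = 5" "u \<subseteq> vertices"
      using u by (auto simp: pentachora_def)
    then have "finite u" by (auto intro: card_ge_0_finite)
    then obtain vs where vs: "set vs = u" "distinct vs"
      using finite_distinct_list by blast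
    then have "length vs = 5" using \<open>card u = 5\<close> distinct_card by fastforce
    then obtain a b c d v where "vs = [a, b, c, d, v]"
      by (auto simp: numeral_eq_Suc length_Suc_conv)
    with vs \<open>u \<subseteq> vertices\<close> have "vertex_list [a, b, c, d, v]" "u = {a, b, c, d, v}"
      by auto
    then show ?thesis
      using pentachoron_exact[of a b c d v k'] k'_u that by auto
  qed
  obtain x where x: "x \<in> vertices" "u = vertices - {x}"
    using pentachoron_label[OF u] by metis
  define Y where "Y = {y \<in> vertices. vertices - {y} \<in> C}"
  have "x \<notin> Y"
    using x insert.hyps by (auto simp: Y_def)
  have "\<exists>l. \<forall>x\<in>{x}. \<forall>y\<in>Y. \<forall>e\<in>edges_of (vertices - {x, y}). \<psi>' e = gauge \<gamma> l e"
  proof (rule common_gauge)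
    show "{x} \<subseteq> vertices" "Y \<subseteq> vertices" "{x} \<inter> Y = {}"
      using x \<open>x \<notin> Y\<close> by (auto simp: Y_def)
    fix x' y assume "x' \<in> {x}" and y: "y \<in> Y"
    then have [simp]: "x' = x" by simp
    have t: "vertices - {x, y} \<in> tetrahedra"
      using x y \<open>x \<notin> Y\<close> by (intro tetrahedron_label) (auto simp: Y_def)
    then have "vertices - {x, y} \<in> tets_of C"
      using y by (auto simp: tets_of_def Y_def)
    moreover have "vertices - {x, y} \<subseteq> u"
      using x by auto
    ultimately show "induced_coloring \<gamma> \<psi>' (vertices - {x', y}) = 0"
      using \<psi>' t k'_C by auto
  qed
  then obtain l where l: "\<And>y e. y \<in> Y \<Longrightarrow> e \<in> edges_of (vertices - {x, y}) \<Longrightarrow> \<psi>' e = gauge \<gamma> l e"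
    by auto
  define \<phi> where "\<phi> e = (if e \<subseteq> u then \<psi>' e - gauge \<gamma> l e else 0)" for e
  have \<phi>_u: "induced_coloring \<gamma> \<phi> t = k' t" if "t \<in> tetrahedra" "t \<subseteq> u" for t
  proof -
    have "induced_coloring \<gamma> \<phi> t = induced_coloring \<gamma> (\<lambda>e. \<psi>' e - gauge \<gamma> l e) t"
      by (rule induced_cong) (use that in \<open>auto simp: edges_of_def \<phi>_def\<close>)
    then show ?thesis
      using \<psi>' that by (simp add: induced_diff_gauge)
  qed
  have \<phi>_C: "induced_coloring \<gamma> \<phi> t = k' t" if t: "t \<in> tets_of C" for t
  proof -
    from t obtain u' where u': "u' \<in> C" "t \<subseteq> u'"
      by (auto simp: tets_of_def)
    then obtain y where y: "y \<in> vertices" "u' = vertices - {y}"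
      using C pentachoron_label by blast
    then have "y \<in> Y" using u' by (auto simp: Y_def)
    have "induced_coloring \<gamma> \<phi> t = 0"
    proof (rule induced_zero)
      fix e assume "e \<in> edges_of t"
      then have "e \<in> edges_of (vertices - {x, y})" if "e \<subseteq> u"
        using that u' y x by (auto simp: edges_of_def)
      then show "\<phi> e = 0"
        using l[OF \<open>y \<in> Y\<close>] by (auto simp: \<phi>_def)
    qed
    then show ?thesis using k'_C[OF t] by simp
  qed
  have "k t = induced_coloring \<gamma> (\<lambda>e. \<psi> e + \<phi> e) t" if "t \<in> tets_of (insert u C)" for t
  proof -
    have "induced_coloring \<gamma> \<phi> t = k' t"
      using that \<phi>_u \<phi>_C by (auto simp: tets_of_def)
    then show ?thesis by (simp add: induced_coloring_add k'_def)
  qed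
  then show ?case by blast
qed

lemma permitted_eq_induced:
  assumes "C \<subseteq> pentachora"
  shows "permitted \<gamma> C = range (\<lambda>\<psi>. restrict_coloring (tets_of C) (induced_coloring \<gamma> \<psi>))"
proof (intro equalityI subsetI)
  fix k assume k: "k \<in> permitted \<gamma> C"
  have "finite C"
    by (rule finite_subset[OF assms]) (simp add: pentachora_def vertices_def)
  then obtain \<psi> where "\<forall>t\<in>tets_of C. k t = induced_coloring \<gamma> \<psi> t"
    using permitted_imp_induced[of C k] assms k by (auto simp: permitted_def)
  then have "k = restrict_coloring (tets_of C) (induced_coloring \<gamma> \<psi>)"
    using k by (auto simp: fun_eq_iff restrict_coloring_def permitted_def colorings_def)
  then show "k \<in> range (\<lambda>\<psi>. restrict_coloring (tets_of C) (induced_coloring \<gamma> \<psi>))"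
    by blast
next
  fix k assume "k \<in> range (\<lambda>\<psi>. restrict_coloring (tets_of C) (induced_coloring \<gamma> \<psi>))"
  then obtain \<psi> where k: "k = restrict_coloring (tets_of C) (induced_coloring \<gamma> \<psi>)" by blast
  have "edge_functional \<gamma> 1 u e k = 0" if "u \<in> C" "e \<in> edges_of u" for u e
  proof -
    have "edge_functional \<gamma> 1 u e k = edge_functional \<gamma> 1 u e (induced_coloring \<gamma> \<psi>)"
      by (rule edge_functional_cong) (use that in \<open>auto simp: k restrict_coloring_def tets_of_def\<close>)
    then show ?thesis
      using edge_functional_induced that assms by auto
  qed
  then show "k \<in> permitted \<gamma> C"
    by (auto simp: permitted_def colorings_def k restrict_coloring_def)
qed

end

section \<open>Bases of spaces of induced colorings\<close>

text \<open>Linear independence of an indexed family, turned into statements about its image; injectivity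
  follows from independence.\<close>

lemma family_span:
  fixes g :: "nat set \<Rightarrow> 'a::field coloring"
  assumes S: "finite S"
    and indep: "\<And>x e. (\<Sum>e\<in>S. scale_coloring (x e) (g e)) = 0 \<Longrightarrow> e \<in> S \<Longrightarrow> x e = 0"
  shows "coloring.independent (g ` S)" "card (g ` S) = card S"
    "coloring.span (g ` S) = range (\<lambda>x. \<Sum>e\<in>S. scale_coloring (x e) (g e))"
proof -
  have inj: "inj_on g S"
  proof (rule inj_onI, rule ccontr)
    fix e f assume ef: "e \<in> S" "f \<in> S" "g e = g f" "e \<noteq> f"
    \<comment> \<open>If two members coincide, their difference is a nontrivial relation.\<close>
    let ?x = "\<lambda>h. if h = e then 1 else if h = f then - 1 else (0 :: 'a)"
    have "(\<Sum>h\<in>S. scale_coloring (?x h) (g h)) = (\<Sum>h\<in>{e, f}. scale_coloring (?x h) (g h))"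
      using ef S by (intro sum.mono_neutral_right) auto
    also have "\<dots> = 0"
      using ef by simp
    finally have "?x e = 0"
      by (rule indep[of ?x e]) (use ef in simp)
    then show False by simp
  qed
  show "card (g ` S) = card S" using inj by (rule card_image)
  have sums: "(\<Sum>v\<in>g ` S. scale_coloring (y v) v) = (\<Sum>e\<in>S. scale_coloring (y (g e)) (g e))" for y
    by (simp add: sum.reindex[OF inj])
  show "coloring.independent (g ` S)"
    unfolding coloring.dependent_finite[OF finite_imageI[OF S]] sums
    using indep[of "\<lambda>e. _ (g e)"] by blast
  have to_span: "(\<Sum>e\<in>S. scale_coloring (x e) (g e)) \<in> range (\<lambda>y. \<Sum>e\<in>S. scale_coloring (y (g e)) (g e))" for x
    by (rule image_eqI[of _ _ "x \<circ> the_inv_into S g"])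
      (auto intro!: sum.cong simp: the_inv_into_f_f[OF inj])
  then show "coloring.span (g ` S) = range (\<lambda>x. \<Sum>e\<in>S. scale_coloring (x e) (g e))"
    unfolding coloring.span_finite[OF finite_imageI[OF S]] sums
  proof (intro equalityI subsetI)
    fix k assume "k \<in> range (\<lambda>y. \<Sum>e\<in>S. scale_coloring (y (g e)) (g e))"
    then obtain y where "k = (\<Sum>e\<in>S. scale_coloring (y (g e)) (g e))" by blast
    then show "k \<in> range (\<lambda>x. \<Sum>e\<in>S. scale_coloring (x e) (g e))"
      by (rule image_eqI[of _ _ "y \<circ> g", unfolded comp_def]) simp
  qed (use to_span in auto)
qed

lemma restrict_coloring_add:
  "restrict_coloring T (k + k') = restrict_coloring T k + restrict_coloring T k'"
  by (auto simp: restrict_coloring_def)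

lemma restrict_coloring_scale:
  "restrict_coloring T (scale_coloring x k) = scale_coloring x (restrict_coloring T k)"
  by (auto simp: restrict_coloring_def scale_coloring_def zero_prod_def)

lemma restrict_restrict:
  "T \<subseteq> T' \<Longrightarrow> restrict_coloring T (restrict_coloring T' k) = restrict_coloring T k"
  by (auto simp: restrict_coloring_def fun_eq_iff)

lemma restrict_eq_iff:
  "restrict_coloring T k = restrict_coloring T k' \<longleftrightarrow> (\<forall>t\<in>T. k t = k' t)"
  by (auto simp: restrict_coloring_def fun_eq_iff)

lemma restrict_eq_zero_iff: "restrict_coloring T k = 0 \<longleftrightarrow> (\<forall>t\<in>T. k t = 0)"
  by (auto simp: restrict_coloring_def fun_eq_iff)

context generic_coefficients
begin

definition restricted_induced :: "nat set set \<Rightarrow> (nat set \<Rightarrow> 'a) \<Rightarrow> 'a coloring" where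
  "restricted_induced T \<psi> = restrict_coloring T (induced_coloring \<gamma> \<psi>)"

definition weights_on :: "nat set set \<Rightarrow> (nat set \<Rightarrow> 'a) set" where
  "weights_on S = {\<psi>. \<forall>e. e \<notin> S \<longrightarrow> \<psi> e = 0}"

lemma restricted_induced_add:
  "restricted_induced T (\<lambda>e. \<psi> e + \<phi> e) = restricted_induced T \<psi> + restricted_induced T \<phi>"
  by (simp add: restricted_induced_def induced_coloring_add restrict_coloring_add)

lemma restricted_induced_scale:
  "restricted_induced T (\<lambda>e. x * \<psi> e) = scale_coloring x (restricted_induced T \<psi>)"
  by (simp add: restricted_induced_def induced_coloring_scale restrict_coloring_scale)

lemma restricted_induced_sum:
  assumes "finite S"
  shows "(\<Sum>e\<in>S. scale_coloring (x e) (restricted_induced T (\<lambda>h. if h = e then 1 else 0))) =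
    restricted_induced T (\<lambda>h. if h \<in> S then x h else 0)"
  using assms
proof (induction S rule: finite_induct)
  case empty
  show ?case
    using restricted_induced_scale[of T 0 "\<lambda>_. 0"]
    by (auto simp: scale_coloring_def zero_prod_def fun_eq_iff)
next
  case (insert e S)
  have "(\<lambda>h. if h \<in> insert e S then x h else 0) =
      (\<lambda>h. x e * (if h = e then 1 else 0) + (if h \<in> S then x h else 0))"
    using insert.hyps by auto
  then have "restricted_induced T (\<lambda>h. if h \<in> insert e S then x h else 0) =
      scale_coloring (x e) (restricted_induced T (\<lambda>h. if h = e then 1 else 0)) +
      restricted_induced T (\<lambda>h. if h \<in> S then x h else 0)"
    by (simp only: restricted_induced_add restricted_induced_scale)
  then show ?case
    unfolding sum.insert[OF insert.hyps] insert.IH by (rule sym)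
qed

text \<open>The basis consists of the colorings induced by single edges of \<open>S\<close>.\<close>

lemma restricted_induced_basis:
  assumes S: "finite S"
    and inj: "\<And>\<psi>. \<psi> \<in> weights_on S \<Longrightarrow> restricted_induced T \<psi> = 0 \<Longrightarrow> \<forall>e. \<psi> e = 0"
  shows "\<exists>B. finite B \<and> card B = card S \<and> coloring.independent B \<and>
    coloring.span B = restricted_induced T ` weights_on S"
proof -
  let ?g = "\<lambda>e. restricted_induced T (\<lambda>h. if h = e then 1 else 0)"
  have indep: "x e = 0" if "(\<Sum>e\<in>S. scale_coloring (x e) (?g e)) = 0" "e \<in> S" for x e
  proof -
    have "(if e \<in> S then x e else 0) = 0"
      by (rule inj[of "\<lambda>h. if h \<in> S then x h else 0", THEN spec])
        (use that in \<open>simp_all add: restricted_induced_sum[OF S] weights_on_def\<close>)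
    with that show ?thesis by simp
  qed
  have family: "coloring.independent (?g ` S)" "card (?g ` S) = card S"
    "coloring.span (?g ` S) = range (\<lambda>x. \<Sum>e\<in>S. scale_coloring (x e) (?g e))"
    by (rule family_span[OF S]; rule indep; assumption)+
  have "range (\<lambda>x. \<Sum>e\<in>S. scale_coloring (x e) (?g e)) = restricted_induced T ` weights_on S"
  proof (intro equalityI subsetI)
    fix k assume "k \<in> restricted_induced T ` weights_on S"
    then obtain \<psi> where \<psi>: "k = restricted_induced T \<psi>" "\<psi> \<in> weights_on S" by blast
    have eq: "(\<lambda>h. if h \<in> S then \<psi> h else 0) = \<psi>"
      using \<psi>(2) by (auto simp: weights_on_def)
    show "k \<in> range (\<lambda>x. \<Sum>e\<in>S. scale_coloring (x e) (?g e))"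
      unfolding restricted_induced_sum[OF S] by (rule image_eqI[of _ _ \<psi>]) (simp_all add: eq \<psi>)
  qed (auto simp: restricted_induced_sum[OF S] weights_on_def)
  with family S show ?thesis
    by (intro exI[of _ "?g ` S"]) simp
qed

text \<open>The principle of gauge fixing: weights may be replaced by gauge equivalent ones with smaller
  support.\<close>

lemma restricted_induced_gauge_cong:
  assumes "\<And>e. e \<in> edges_of vertices \<Longrightarrow> \<phi> e = \<psi> e - gauge \<gamma> l e"
  shows "restricted_induced T \<phi> = restricted_induced T \<psi>"
proof -
  have "induced_coloring \<gamma> \<phi> t = induced_coloring \<gamma> \<psi> t" for t
  proof (cases "t \<in> tetrahedra")
    case True
    have "induced_coloring \<gamma> \<phi> t = induced_coloring \<gamma> (\<lambda>e. \<psi> e - gauge \<gamma> l e) t"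
      by (rule induced_cong) (use True assms in \<open>auto simp: edges_of_def tetrahedra_def\<close>)
    then show ?thesis by (simp add: induced_diff_gauge)
  qed (simp add: induced_coloring_def)
  then have "induced_coloring \<gamma> \<phi> = induced_coloring \<gamma> \<psi>" by (rule ext)
  then show ?thesis by (simp add: restricted_induced_def)
qed

lemma restricted_induced_tetrahedra_zero:
  assumes "restricted_induced tetrahedra \<psi> = 0"
  obtains l where "\<And>e. e \<in> edges_of vertices \<Longrightarrow> \<psi> e = gauge \<gamma> l e"
  using global_gauge[of \<psi>] assms by (auto simp: restricted_induced_def restrict_eq_zero_iff)

section \<open>Permitted colorings of the whole boundary\<close>

text \<open>The six gauge parameters are used up by making the weights of the disjoint triangles \<open>123\<close> and
  \<open>456\<close> zero, which is possible in exactly one way.  The nine edges between the two triangles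
  then provide a basis.\<close>

lemma dim_permitted_pentachora: "coloring.dim (permitted \<gamma> pentachora) = 9"
proof -
  define S where "S = (\<lambda>(i, j). {i, j}) ` ({1, 2, 3 :: nat} \<times> {4, 5, 6})"
  have "inj_on (\<lambda>(i, j). {i, j}) ({1, 2, 3 :: nat} \<times> {4, 5, 6 :: nat})"
    by (auto simp: inj_on_def doubleton_eq_iff)
  then have card_S: "card S = 9"
    unfolding S_def by (subst card_image) simp_all
  have finite_S: "finite S" by (simp add: S_def)
  have edge_cases: "e \<in> S \<or> e \<in> edges_of {1, 2, 3} \<or> e \<in> edges_of {4, 5, 6}"
    if e: "e \<in> edges_of vertices" for e
  proof -
    obtain i j where ij: "e = {i, j}" "i \<noteq> j" "i \<in> {1, 2, 3} \<union> {4, 5, 6}" "j \<in> {1, 2, 3} \<union> {4, 5, 6}"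
      using e by (auto simp: edges_of_def card_2_iff vertices_eq)
    have "i \<in> {1, 2, 3} \<Longrightarrow> j \<in> {4, 5, 6} \<Longrightarrow> {i, j} \<in> S" for i j
      unfolding S_def by (rule image_eqI[of _ _ "(i, j)"]) auto
    from this[of i j] this[of j i] ij show ?thesis
      unfolding edges_of_def by (auto simp: insert_commute)
  qed
  have span: "permitted \<gamma> pentachora = restricted_induced tetrahedra ` weights_on S"
  proof (intro equalityI subsetI)
    fix k assume "k \<in> permitted \<gamma> pentachora"
    then obtain \<psi> where k: "k = restricted_induced tetrahedra \<psi>"
      by (auto simp: permitted_eq_induced tets_of_pentachora restricted_induced_def)
    obtain l1 where l1: "\<forall>e\<in>edges_of {1, 2, 3}. \<psi> e = gauge \<gamma> l1 e"
      using triangle_gauge[of 1 2 3 \<psi>] by (auto simp: vertices_eq)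
    obtain l2 where l2: "\<forall>e\<in>edges_of {4, 5, 6}. \<psi> e = gauge \<gamma> l2 e"
      using triangle_gauge[of 4 5 6 \<psi>] by (auto simp: vertices_eq)
    define l where "l i = (if i \<in> {1, 2, 3} then l1 i else l2 i)" for i
    define \<phi> where "\<phi> e = (if e \<in> S then \<psi> e - gauge \<gamma> l e else 0)" for e
    have "\<psi> e = gauge \<gamma> l e" if "e \<in> edges_of {1, 2, 3} \<or> e \<in> edges_of {4, 5, 6}" for e
    proof -
      have "gauge \<gamma> l e = gauge \<gamma> l1 e" if "e \<in> edges_of {1, 2, 3}"
        using that by (rule gauge_cong) (simp add: l_def)
      moreover have "gauge \<gamma> l e = gauge \<gamma> l2 e" if "e \<in> edges_of {4, 5, 6}"
        using that by (rule gauge_cong) (auto simp: l_def)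
      ultimately show ?thesis using that l1 l2 by auto
    qed
    then have "\<phi> e = \<psi> e - gauge \<gamma> l e" if "e \<in> edges_of vertices" for e
      using edge_cases[OF that] by (auto simp: \<phi>_def)
    then have "k = restricted_induced tetrahedra \<phi>"
      unfolding k by (rule restricted_induced_gauge_cong[symmetric])
    then show "k \<in> restricted_induced tetrahedra ` weights_on S"
      by (auto simp: weights_on_def \<phi>_def)
  qed (auto simp: permitted_eq_induced tets_of_pentachora restricted_induced_def)
  have inj: "\<psi> e = 0"
    if \<psi>: "\<psi> \<in> weights_on S" and zero: "restricted_induced tetrahedra \<psi> = 0" for \<psi> e
  proof -
    obtain l where l: "\<And>e. e \<in> edges_of vertices \<Longrightarrow> \<psi> e = gauge \<gamma> l e"
      using restricted_induced_tetrahedra_zero[OF zero] by blast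
    have triangle: "l a = 0" if "vertex_list [a, b, c]" "{a, b, c} \<subseteq> {1, 2, 3} \<or> {a, b, c} \<subseteq> {4, 5, 6}" for a b c
    proof (rule gauge_zero_on_triangle[OF that(1)])
      have "gauge \<gamma> l {i, j} = 0" if "i \<in> {a, b, c}" "j \<in> {a, b, c}" "i \<noteq> j" for i j
      proof -
        have "{i, j} \<in> edges_of vertices" using that \<open>vertex_list [a, b, c]\<close>
          by (auto simp: edges_of_def)
        moreover have "{i, j} \<notin> S"
        proof
          assume "{i, j} \<in> S"
          then obtain i' j' where ij': "{i, j} = {i', j'}" "i' \<in> {1, 2, 3}" "j' \<in> {4, 5, 6}"
            by (auto simp: S_def)
          have "i' \<in> {a, b, c}" "j' \<in> {a, b, c}"
            using ij'(1) that by (auto simp: doubleton_eq_iff)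
          then have "i' \<in> {4, 5, 6} \<or> j' \<in> {1, 2, 3}"
            using \<open>_ \<or> _\<close> by blast
          then show False using ij'(2,3) by auto
        qed
        ultimately show ?thesis using l \<psi> by (auto simp: weights_on_def)
      qed
      then show "gauge \<gamma> l {a, b} = 0" "gauge \<gamma> l {a, c} = 0" "gauge \<gamma> l {b, c} = 0"
        using that(1) by auto
    qed
    have "l 1 = 0" "l 2 = 0" "l 3 = 0" "l 4 = 0" "l 5 = 0" "l 6 = 0"
      by (rule triangle[of 1 2 3] triangle[of 2 1 3] triangle[of 3 1 2]
        triangle[of 4 5 6] triangle[of 5 4 6] triangle[of 6 4 5]; simp add: vertices_eq)+
    then have "l a = 0" if "a \<in> vertices" for a
      using that by (auto simp: vertices_eq)
    then have "\<psi> e = 0" if "e \<in> edges_of vertices"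
      using l[OF that] gauge_cong[OF that, of l "\<lambda>_. 0"] by (simp add: gauge_zero)
    moreover have "\<psi> e = 0" if "e \<notin> edges_of vertices"
    proof -
      have "S \<subseteq> edges_of vertices" by (auto simp: S_def edges_of_def vertices_eq)
      then show ?thesis using that \<psi> by (auto simp: weights_on_def)
    qed
    ultimately show ?thesis by blast
  qed
  obtain B where "card B = 9" "coloring.independent B" "coloring.span B = permitted \<gamma> pentachora"
    using restricted_induced_basis[OF finite_S, of tetrahedra] inj card_S span by metis
  then show ?thesis
    using coloring.dim_span_eq_card_independent[of B] by simp
qed

section \<open>Permitted colorings invisible on the boundary\<close>

text \<open>A weight that induces zero on the boundary is a gauge there, and after subtracting the gauge it
  vanishes on all boundary edges.  An edge is not in the boundary if it contains all of \<open>omitted C\<close> or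
  all of its complement; in the first case it does not belong to \<open>C\<close>, so only the second case
  contributes.\<close>

lemma invisible_permitted:
  assumes C: "C \<subseteq> pentachora"
  shows "{k \<in> permitted \<gamma> C. restrict_coloring (bdry_tets C) k = 0} =
    restricted_induced (tets_of C) ` weights_on {e \<in> edges_of vertices. vertices - omitted C \<subseteq> e}"
    (is "?K = _ ` weights_on ?S")
proof (intro equalityI subsetI)
  fix k assume k: "k \<in> ?K"
  then obtain \<psi> where \<psi>: "k = restricted_induced (tets_of C) \<psi>"
    by (auto simp: permitted_eq_induced[OF C] restricted_induced_def)
  have "\<exists>l. \<forall>x\<in>omitted C. \<forall>y\<in>vertices - omitted C. \<forall>e\<in>edges_of (vertices - {x, y}). \<psi> e = gauge \<gamma> l e"
  proof (rule common_gauge)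
    fix x y assume xy: "x \<in> omitted C" "y \<in> vertices - omitted C"
    then have t: "vertices - {x, y} \<in> tetrahedra"
      using omitted_subset by (intro tetrahedron_label) auto
    then have bdry: "vertices - {x, y} \<in> bdry_tets C" and tets: "vertices - {x, y} \<in> tets_of C"
      using xy by (auto simp: bdry_tets_iff[OF C] tets_of_iff[OF C])
    then have "k (vertices - {x, y}) = 0"
      using k bdry by (simp add: restrict_eq_zero_iff)
    moreover have "k (vertices - {x, y}) = induced_coloring \<gamma> \<psi> (vertices - {x, y})"
      using tets
      by (simp add: \<psi> restricted_induced_def restrict_coloring_def)
    ultimately show "induced_coloring \<gamma> \<psi> (vertices - {x, y}) = 0"
      by simp
  qed (use omitted_subset in auto)
  then obtain l where l: "\<And>x y e. x \<in> omitted C \<Longrightarrow> y \<in> vertices - omitted C \<Longrightarrow>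
      e \<in> edges_of (vertices - {x, y}) \<Longrightarrow> \<psi> e = gauge \<gamma> l e"
    by metis
  define \<phi> where "\<phi> e = (if e \<in> ?S then \<psi> e - gauge \<gamma> l e else 0)" for e
  have "induced_coloring \<gamma> \<psi> t = induced_coloring \<gamma> \<phi> t" if t: "t \<in> tets_of C" for t
  proof -
    obtain x where x: "x \<in> omitted C" "x \<notin> t" and t': "t \<in> tetrahedra"
      using t by (auto simp: tets_of_iff[OF C])
    have "induced_coloring \<gamma> (\<lambda>e. \<psi> e - gauge \<gamma> l e) t = induced_coloring \<gamma> \<phi> t"
    proof (rule induced_cong)
      fix e assume "e \<in> edges_of t"
      with t' x have e: "e \<in> edges_of vertices" "x \<notin> e"
        by (auto simp: edges_of_def tetrahedra_def)
      show "\<psi> e - gauge \<gamma> l e = \<phi> e"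
      proof (cases "vertices - omitted C \<subseteq> e")
        case False
        then obtain y where "y \<in> vertices - omitted C" "y \<notin> e" by blast
        with x e have "\<psi> e = gauge \<gamma> l e"
          by (intro l[of x y]) (auto simp: edges_of_def)
        with False show ?thesis by (simp add: \<phi>_def)
      qed (use e in \<open>simp add: \<phi>_def\<close>)
    qed
    then show ?thesis by (simp add: induced_diff_gauge)
  qed
  then have "k = restricted_induced (tets_of C) \<phi>"
    by (simp add: \<psi> restricted_induced_def restrict_eq_iff)
  moreover have "\<phi> \<in> weights_on ?S"
    by (simp add: weights_on_def \<phi>_def)
  ultimately show "k \<in> restricted_induced (tets_of C) ` weights_on ?S"
    by blast
next
  fix k assume "k \<in> restricted_induced (tets_of C) ` weights_on ?S"
  then obtain \<psi> where k: "k = restricted_induced (tets_of C) \<psi>" and \<psi>: "\<psi> \<in> weights_on ?S"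
    by blast
  have "k t = 0" if t: "t \<in> bdry_tets C" for t
  proof -
    obtain y where y: "y \<in> vertices - omitted C" "y \<notin> t"
      using t by (auto simp: bdry_tets_iff[OF C])
    have "induced_coloring \<gamma> \<psi> t = 0"
    proof (rule induced_zero)
      fix e assume "e \<in> edges_of t"
      with y have "e \<notin> ?S" by (auto simp: edges_of_def)
      with \<psi> show "\<psi> e = 0" by (simp add: weights_on_def)
    qed
    then show ?thesis by (simp add: k restricted_induced_def restrict_coloring_def)
  qed
  moreover have "k \<in> permitted \<gamma> C"
    by (auto simp: k permitted_eq_induced[OF C] restricted_induced_def)
  ultimately show "k \<in> ?K" by (simp add: restrict_eq_zero_iff)
qed

text \<open>The edge \<open>Y = {p, q}\<close> is contained in a tetrahedron \<open>pqcd\<close> of \<open>C\<close>.  If the induced color is zero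
  there, then the potentials of \<open>pqc\<close> at \<open>p\<close> and at \<open>q\<close> are those of the triangles \<open>pcd\<close> and
  \<open>qcd\<close>, whose edges have weight zero.\<close>

lemma single_edge_faithful:
  assumes C: "C \<subseteq> pentachora" "card C = 4" and Y: "Y = vertices - omitted C"
    and \<psi>: "\<psi> \<in> weights_on {Y}" "restricted_induced (tets_of C) \<psi> = 0"
  shows "\<psi> Y = 0"
proof -
  have "card (omitted C) = 4" using card_omitted C by simp
  then obtain a b c d where abcd: "distinct [a, b, c, d]" "omitted C = {a, b, c, d}"
    using omitted_subset[of C] tetrahedron_iff[of "omitted C"] by (auto simp: tetrahedra_def)
  have "card Y = 2"
    using \<open>card (omitted C) = 4\<close> omitted_subset[of C]
    by (subst Y, subst card_Diff_subset) (auto simp: vertices_def finite_subset)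
  then obtain p q where pq: "Y = {p, q}" "p \<noteq> q" by (auto simp: card_2_iff)
  have vl: "vertex_list [p, q, c, d]"
    using pq Y abcd omitted_subset[of C] by auto
  let ?t = "{p, q, c, d}"
  have t: "?t \<in> tetrahedra"
    using vl tetrahedron_iff by blast
  moreover have "a \<notin> ?t"
    using pq Y abcd by auto
  ultimately have "?t \<in> tets_of C"
    using abcd by (auto simp: tets_of_iff[OF C(1)])
  then have zero: "induced_coloring \<gamma> \<psi> ?t = 0"
    using \<psi>(2) by (auto simp: restricted_induced_def restrict_eq_zero_iff)
  have eq: "potential \<gamma> \<psi> i j k = potential \<gamma> \<psi> i j h"
    if "?t = {i, j, k, h}" "distinct [i, j, k, h]" for i j k h
    using induced_zero_iff[OF t] zero that by blast
  have "?t = {p, c, q, d}" "?t = {q, c, p, d}" by auto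
  then have "potential \<gamma> \<psi> p c q = potential \<gamma> \<psi> p c d" "potential \<gamma> \<psi> q c p = potential \<gamma> \<psi> q c d"
    using vl by (auto intro!: eq)
  moreover have "potential \<gamma> \<psi> p c d = 0" "potential \<gamma> \<psi> q c d = 0"
    by (rule potential_zero; use \<psi>(1) vl in \<open>auto simp: weights_on_def pq doubleton_eq_iff\<close>)+
  ultimately show ?thesis
    using edge_eq_potentials[of p q c \<psi>] vl
    by (auto simp: pq potential_swap[of \<gamma> \<psi> p q c] potential_swap[of \<gamma> \<psi> q p c])
qed

text \<open>Of the six gauge parameters, only the one at \<open>y\<close> preserves the condition that the weights vanish
  outside the star of \<open>y\<close>.  It is used to remove one edge \<open>yi\<close>, and the other four edges at \<open>y\<close>
  provide a basis.\<close>

lemma star_basis: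
  assumes y: "y \<in> vertices"
  shows "\<exists>B. finite B \<and> card B = 4 \<and> coloring.independent B \<and>
    coloring.span B = restricted_induced tetrahedra ` weights_on {e \<in> edges_of vertices. y \<in> e}"
proof -
  let ?star = "{e \<in> edges_of vertices. y \<in> e}"
  obtain i where i: "i \<in> vertices" "i \<noteq> y"
    by (rule that[of "if y = 1 then 2 else 1"]) (auto simp: vertices_def)
  define S where "S = (\<lambda>j. {y, j}) ` (vertices - {y, i})"
  have "inj_on (\<lambda>j. {y, j}) (vertices - {y, i})"
    by (auto simp: inj_on_def doubleton_eq_iff)
  then have "card S = card (vertices - {y, i})"
    unfolding S_def by (rule card_image)
  also have "\<dots> = 4"
    using tetrahedron_label[of y i] i y by (auto simp: tetrahedra_def)
  finally have card_S: "card S = 4" .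
  have finite_S: "finite S" by (simp add: S_def vertices_def)
  have star: "e \<in> S \<or> e = {y, i}" if "e \<in> ?star" for e
    using that by (auto simp: edges_of_def card_2_iff S_def insert_commute)
  have S_y: "y \<in> e" if "e \<in> S" for e
    using that by (auto simp: S_def)
  have S_star: "S \<subseteq> ?star"
    using y by (auto simp: S_def edges_of_def)
  have "restricted_induced tetrahedra ` weights_on ?star = restricted_induced tetrahedra ` weights_on S"
  proof (intro equalityI subsetI)
    fix k assume "k \<in> restricted_induced tetrahedra ` weights_on ?star"
    then obtain \<psi> where k: "k = restricted_induced tetrahedra \<psi>" and \<psi>: "\<psi> \<in> weights_on ?star"
      by blast
    \<comment> \<open>The gauge at \<open>y\<close> alone whose value on \<open>yi\<close> is \<open>\<psi> {y, i}\<close>.\<close>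
    define l where "l j = (if j = y then \<psi> {y, i} / \<gamma> i y else 0)" for j
    define \<phi> where "\<phi> e = (if e \<in> S then \<psi> e - gauge \<gamma> l e else 0)" for e
    have "\<phi> e = \<psi> e - gauge \<gamma> l e" if e: "e \<in> edges_of vertices" for e
    proof (cases "e \<in> ?star")
      case True
      have "gauge \<gamma> l {y, i} = \<psi> {y, i}"
        using i y coeff_nonzero[of i y] by (simp add: gauge_edge l_def)
      then show ?thesis
        using star[OF True] by (auto simp: \<phi>_def)
    next
      case False
      then have "e \<in> edges_of (vertices - {y})"
        using e by (auto simp: edges_of_def)
      then have "gauge \<gamma> l e = gauge \<gamma> (\<lambda>_. 0) e"
        by (rule gauge_cong) (simp add: l_def)
      moreover have "\<psi> e = 0" "\<phi> e = 0"
        using False \<psi> S_star by (auto simp: weights_on_def \<phi>_def)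
      ultimately show ?thesis by (simp add: gauge_zero)
    qed
    then have "k = restricted_induced tetrahedra \<phi>"
      unfolding k by (rule restricted_induced_gauge_cong[symmetric])
    moreover have "\<phi> \<in> weights_on S"
      by (simp add: weights_on_def \<phi>_def)
    ultimately show "k \<in> restricted_induced tetrahedra ` weights_on S"
      by blast
  next
    fix k assume "k \<in> restricted_induced tetrahedra ` weights_on S"
    then show "k \<in> restricted_induced tetrahedra ` weights_on ?star"
      using S_star by (auto simp: weights_on_def)
  qed
  moreover have "\<forall>e. \<psi> e = 0"
    if \<psi>: "\<psi> \<in> weights_on S" and zero: "restricted_induced tetrahedra \<psi> = 0" for \<psi>
  proof -
    obtain l where l: "\<And>e. e \<in> edges_of vertices \<Longrightarrow> \<psi> e = gauge \<gamma> l e"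
      using restricted_induced_tetrahedra_zero[OF zero] by blast
    have l_away: "l a = 0" if a: "a \<in> vertices - {y}" for a
    proof -
      have "2 \<le> card (vertices - {a, y})"
        using tetrahedron_label[of a y] a y by (simp add: tetrahedra_def)
      then obtain E where "E \<subseteq> vertices - {a, y}" "card E = 2"
        by (meson obtain_subset_with_card_n)
      then obtain b c where "b \<noteq> c" "b \<in> vertices - {a, y}" "c \<in> vertices - {a, y}"
        by (auto simp: card_2_iff)
      then have bc: "vertex_list [a, b, c]" "y \<notin> {a, b, c}" using a by auto
      have sub: "{a, b, c} \<subseteq> vertices - {y}"
        using bc by auto
      have "gauge \<gamma> l {j, k} = 0" if "j \<in> {a, b, c}" "k \<in> {a, b, c}" "j \<noteq> k" for j k
      proof -
        have "{j, k} \<subseteq> vertices - {y}"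
          using that(1,2) sub by blast
        then have edge: "{j, k} \<in> edges_of vertices" and "{j, k} \<notin> S"
          using \<open>j \<noteq> k\<close> S_y unfolding edges_of_def by auto
        then have "\<psi> {j, k} = 0" using \<psi> by (simp add: weights_on_def)
        then show ?thesis using l[OF edge] by simp
      qed
      then have "gauge \<gamma> l {a, b} = 0" "gauge \<gamma> l {a, c} = 0" "gauge \<gamma> l {b, c} = 0"
        using bc(1) by simp_all
      then show "l a = 0"
        by (rule gauge_zero_on_triangle[OF bc(1)])
    qed
    have yi: "{y, i} \<in> edges_of vertices" "{y, i} \<notin> S"
      using i y by (auto simp: edges_of_def S_def doubleton_eq_iff)
    then have "gauge \<gamma> l {y, i} = 0"
      using l[OF yi(1)] \<psi> by (simp add: weights_on_def)
    then have "l y = 0"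
      using i y l_away[of i] coeff_nonzero[of i y] by (simp add: gauge_edge)
    with l_away have "l a = 0" if "a \<in> vertices" for a
      using that by (cases "a = y") auto
    then have "\<psi> e = 0" if "e \<in> edges_of vertices" for e
      using l[OF that] gauge_cong[OF that, of l "\<lambda>_. 0"] by (simp add: gauge_zero)
    moreover have "\<psi> e = 0" if "e \<notin> edges_of vertices" for e
      using that \<psi> S_star by (auto simp: weights_on_def)
    ultimately show ?thesis by blast
  qed
  ultimately show ?thesis
    using restricted_induced_basis[OF finite_S, of tetrahedra] card_S by simp
qed

text \<open>With \<open>k\<close> pentachora in \<open>C\<close>, the weights are supported on the edges containing the \<open>6 - k\<close>
  vertices outside \<open>omitted C\<close>: none for \<open>k \<le> 3\<close>, one for \<open>k = 4\<close>, and the star of a vertex for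
  \<open>k = 5\<close>.\<close>

lemma invisible_basis:
  assumes C: "C \<subseteq> pentachora" and k: "1 \<le> card C" "card C \<le> 5"
  shows "\<exists>B. finite B \<and> card B = (if card C \<le> 3 then 0 else if card C = 4 then 1 else 4) \<and>
    coloring.independent B \<and>
    coloring.span B = {k \<in> permitted \<gamma> C. restrict_coloring (bdry_tets C) k = 0}"
proof -
  let ?Y = "vertices - omitted C"
  let ?S = "{e \<in> edges_of vertices. ?Y \<subseteq> e}"
  have "card ?Y = card vertices - card (omitted C)"
    using omitted_subset[of C] by (intro card_Diff_subset) (auto simp: vertices_def intro: finite_subset)
  then have card_Y: "card ?Y = 6 - card C"
    using card_omitted[OF C] by (simp add: vertices_def)
  have fin_edge: "finite e" if "e \<in> ?S" for e
    by (rule finite_subset[of e vertices]) (use that in \<open>auto simp: edges_of_def vertices_def\<close>)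
  consider "card C \<le> 3" | "card C = 4" | "card C = 5" using k by linarith
  then show ?thesis
  proof cases
    case 1
    have "card ?Y \<le> 2" if "e \<in> ?S" for e
      using that card_mono[OF fin_edge, of e ?Y] by (auto simp: edges_of_def)
    then have "?S = {}" using card_Y 1 by fastforce
    then show ?thesis
      unfolding invisible_permitted[OF C]
      using restricted_induced_basis[of "{}" "tets_of C"] 1 by (simp add: weights_on_def)
  next
    case 2
    have "e = ?Y" if "e \<in> ?S" for e
      using that card_subset_eq[OF fin_edge, of e ?Y] card_Y 2 by (auto simp: edges_of_def)
    moreover have "?Y \<in> ?S"
      using card_Y 2 by (auto simp: edges_of_def)
    ultimately have S: "?S = {?Y}" by blast
    have "\<exists>B. finite B \<and> card B = card {?Y} \<and> coloring.independent B \<and>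
        coloring.span B = restricted_induced (tets_of C) ` weights_on {?Y}"
    proof (rule restricted_induced_basis)
      fix \<psi> assume \<psi>: "\<psi> \<in> weights_on {?Y}" "restricted_induced (tets_of C) \<psi> = 0"
      then have "\<psi> ?Y = 0"
        by (intro single_edge_faithful[OF C 2 refl])
      with \<psi>(1) show "\<forall>e. \<psi> e = 0"
        unfolding weights_on_def by (metis (mono_tags, lifting) mem_Collect_eq singletonD)
    qed simp
    then show ?thesis
      unfolding invisible_permitted[OF C] S using 2 by simp
  next
    case 3
    then obtain y where y: "?Y = {y}" using card_Y by (auto simp: card_1_singleton_iff)
    have "tets_of C = tetrahedra"
    proof (intro equalityI subsetI)
      fix t assume t: "t \<in> tetrahedra"
      have "card (vertices - t) = 2"
        using t by (subst card_Diff_subset) (auto simp: tetrahedra_def vertices_def intro: finite_subset)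
      then have "\<not> vertices - t \<subseteq> {y}"
        using card_mono[of "{y}" "vertices - t"] by auto
      then show "t \<in> tets_of C"
        using y t by (auto simp: tets_of_iff[OF C])
    qed (simp add: tets_of_iff[OF C])
    moreover have "y \<in> vertices" using y by auto
    ultimately show ?thesis
      unfolding invisible_permitted[OF C] y using star_basis[of y] 3 by simp
  qed
qed

lemma fibre_dimension:
  assumes C: "C \<subseteq> pentachora" and k: "1 \<le> card C" "card C \<le> 5"
    and b: "b \<in> restrict_coloring (bdry_tets C) ` permitted \<gamma> C"
  shows "affine_space_of_dim {c \<in> permitted \<gamma> C. restrict_coloring (bdry_tets C) c = b}
    (if card C \<le> 3 then 0 else if card C = 4 then 1 else 4)"
proof -
  let ?rs = "restrict_coloring (bdry_tets C)"
  obtain c0 where c0: "c0 \<in> permitted \<gamma> C" "b = ?rs c0" using b by blast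
  have "{c \<in> permitted \<gamma> C. ?rs c = b} = (\<lambda>w. c0 + w) ` {w \<in> permitted \<gamma> C. ?rs w = 0}"
  proof (intro equalityI subsetI)
    fix c assume "c \<in> {c \<in> permitted \<gamma> C. ?rs c = b}"
    then have "c - c0 \<in> {w \<in> permitted \<gamma> C. ?rs w = 0}"
      using c0 coloring.subspace_diff[OF subspace_permitted, of c \<gamma> C c0]
      by (auto simp: restrict_eq_zero_iff restrict_eq_iff)
    then show "c \<in> (\<lambda>w. c0 + w) ` {w \<in> permitted \<gamma> C. ?rs w = 0}"
      by (rule image_eqI[rotated]) simp
  next
    fix c assume "c \<in> (\<lambda>w. c0 + w) ` {w \<in> permitted \<gamma> C. ?rs w = 0}"
    then show "c \<in> {c \<in> permitted \<gamma> C. ?rs c = b}"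
      using c0 coloring.subspace_add[OF subspace_permitted]
      by (auto simp: restrict_coloring_add)
  qed
  moreover obtain B where "finite B" "card B = (if card C \<le> 3 then 0 else if card C = 4 then 1 else 4)"
    "coloring.independent B" "coloring.span B = {w \<in> permitted \<gamma> C. ?rs w = 0}"
    using invisible_basis[OF C k] by blast
  ultimately show ?thesis
    unfolding affine_space_of_dim_def by (intro exI[of _ c0] exI[of _ B]) simp
qed

text \<open>Weights on all fifteen edges parametrize the permitted colorings of \<open>C\<close> and of its complement
  simultaneously, which gives the equality of boundary colorings.\<close>

lemma full_hexagon_generic:
  "full_hexagon \<gamma> (\<lambda>k. if k \<le> 3 then 0 else if k = 4 then 1 else 4)"
  unfolding full_hexagon_def Let_def
proof (intro allI impI)
  fix C and k :: nat
  assume C: "C \<subseteq> pentachora" and k: "card C = k" "1 \<le> k" "k \<le> 5"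
  let ?C' = "pentachora - C" and ?rs = "restrict_coloring (bdry_tets C)"
  have C': "?C' \<subseteq> pentachora" by blast
  have "card ?C' = card (vertices - omitted C)"
    using card_omitted[OF C'] by (simp add: omitted_complement)
  also have "\<dots> = 6 - card C"
    using omitted_subset[of C] card_omitted[OF C]
    by (subst card_Diff_subset) (auto simp: vertices_def intro: finite_subset)
  finally have k': "card ?C' = 6 - k" using k by simp
  have image: "?rs ` permitted \<gamma> D = range (\<lambda>\<psi>. ?rs (induced_coloring \<gamma> \<psi>))"
    if "D \<subseteq> pentachora" "bdry_tets C \<subseteq> tets_of D" for D
    unfolding permitted_eq_induced[OF that(1)] image_image restrict_restrict[OF that(2)] ..
  have same: "?rs ` permitted \<gamma> C = ?rs ` permitted \<gamma> ?C'"
    using image[OF C] image[OF C'] by (simp add: bdry_tets_def)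
  moreover have "affine_space_of_dim {c \<in> permitted \<gamma> C. ?rs c = b}
      (if k \<le> 3 then 0 else if k = 4 then 1 else 4)" if "b \<in> ?rs ` permitted \<gamma> C" for b
    using fibre_dimension[OF C _ _ that, unfolded k(1)] k(2,3) by blast
  moreover have "affine_space_of_dim {c \<in> permitted \<gamma> ?C'. ?rs c = b}
      (if 6 - k \<le> 3 then 0 else if 6 - k = 4 then 1 else 4)" if "b \<in> ?rs ` permitted \<gamma> C" for b
    using fibre_dimension[OF C', of b, unfolded bdry_tets_complement[OF C] k'] that k same by simp
  ultimately show "?rs ` permitted \<gamma> C = ?rs ` permitted \<gamma> ?C' \<and>
      (\<forall>b\<in>?rs ` permitted \<gamma> C.
        affine_space_of_dim {c \<in> permitted \<gamma> C. ?rs c = b} (if k \<le> 3 then 0 else if k = 4 then 1 else 4) \<and>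
        affine_space_of_dim {c \<in> permitted \<gamma> ?C'. ?rs c = b}
          (if 6 - k \<le> 3 then 0 else if 6 - k = 4 then 1 else 4))"
    by blast
qed

end

section \<open>The genericity polynomial\<close>

definition monomial_value :: "(nat \<Rightarrow> nat \<Rightarrow> 'a::field) \<Rightarrow> (nat \<times> nat \<Rightarrow>\<^sub>0 nat) \<Rightarrow> 'a" where
  "monomial_value \<gamma> m =
    (\<Prod>v \<in> Poly_Mapping.keys m. \<gamma> (fst v) (snd v) ^ Poly_Mapping.lookup m v)"

definition monomial_degree :: "(nat \<times> nat \<Rightarrow>\<^sub>0 nat) \<Rightarrow> nat" where
  "monomial_degree m = (\<Sum>v \<in> Poly_Mapping.keys m. Poly_Mapping.lookup m v)"

lemma monomial_value_superset:
  "finite K \<Longrightarrow> Poly_Mapping.keys m \<subseteq> K \<Longrightarrow>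
    monomial_value \<gamma> m = (\<Prod>v\<in>K. \<gamma> (fst v) (snd v) ^ Poly_Mapping.lookup m v)"
  unfolding monomial_value_def by (rule prod.mono_neutral_left) (auto simp: in_keys_iff)

lemma monomial_value_add: "monomial_value \<gamma> (m + n) = monomial_value \<gamma> m * monomial_value \<gamma> n"
proof -
  let ?K = "Poly_Mapping.keys m \<union> Poly_Mapping.keys n"
  have "monomial_value \<gamma> p = (\<Prod>v\<in>?K. \<gamma> (fst v) (snd v) ^ Poly_Mapping.lookup p v)"
    if "Poly_Mapping.keys p \<subseteq> ?K" for p
    using that by (intro monomial_value_superset) auto
  from this[of m] this[of n] this[of "m + n"] show ?thesis
    using Poly_Mapping.keys_add[of m n] by (simp add: lookup_add power_add prod.distrib)
qed

lemma monomial_degree_add: "monomial_degree (m + n) = monomial_degree m + monomial_degree n"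
proof -
  let ?K = "Poly_Mapping.keys m \<union> Poly_Mapping.keys n"
  have "monomial_degree p = (\<Sum>v\<in>?K. Poly_Mapping.lookup p v)"
    if "Poly_Mapping.keys p \<subseteq> ?K" for p
    using that unfolding monomial_degree_def
    by (intro sum.mono_neutral_left) (auto simp: in_keys_iff)
  from this[of m] this[of n] this[of "m + n"] show ?thesis
    using Poly_Mapping.keys_add[of m n] by (simp add: lookup_add sum.distrib)
qed

lemma gpoly_eval_superset:
  "finite K \<Longrightarrow> Poly_Mapping.keys P \<subseteq> K \<Longrightarrow>
    gpoly_eval P \<gamma> = (\<Sum>m\<in>K. Poly_Mapping.lookup P m * monomial_value \<gamma> m)"
  unfolding gpoly_eval_def monomial_value_def
  by (rule sum.mono_neutral_left) (auto simp: in_keys_iff)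

lemma gpoly_eval_add: "gpoly_eval (P + Q) \<gamma> = gpoly_eval P \<gamma> + gpoly_eval Q \<gamma>"
proof -
  let ?K = "Poly_Mapping.keys P \<union> Poly_Mapping.keys Q"
  have "gpoly_eval R \<gamma> = (\<Sum>m\<in>?K. Poly_Mapping.lookup R m * monomial_value \<gamma> m)"
    if "Poly_Mapping.keys R \<subseteq> ?K" for R
    using that by (intro gpoly_eval_superset) auto
  from this[of P] this[of Q] this[of "P + Q"] show ?thesis
    using Poly_Mapping.keys_add[of P Q] by (simp add: lookup_add distrib_right sum.distrib)
qed

lemma gpoly_eval_single: "gpoly_eval (Poly_Mapping.single m c) \<gamma> = c * monomial_value \<gamma> m"
  by (simp add: gpoly_eval_def monomial_value_def)

lemma gpoly_eval_sum: "gpoly_eval (\<Sum>i\<in>I. f i) \<gamma> = (\<Sum>i\<in>I. gpoly_eval (f i) \<gamma>)"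
proof -
  have "gpoly_eval 0 \<gamma> = 0" by (simp add: gpoly_eval_def)
  then show ?thesis
    by (induction I rule: infinite_finite_induct) (simp_all add: gpoly_eval_add)
qed

text \<open>This decomposition reduces the multiplicativity of evaluation to monomials.\<close>

lemma sum_of_monomials:
  "(\<Sum>m\<in>Poly_Mapping.keys P. Poly_Mapping.single m (Poly_Mapping.lookup P m)) = P"
proof (rule poly_mapping_eqI)
  fix k
  show "Poly_Mapping.lookup (\<Sum>m\<in>Poly_Mapping.keys P. Poly_Mapping.single m (Poly_Mapping.lookup P m)) k =
      Poly_Mapping.lookup P k"
    by (cases "k \<in> Poly_Mapping.keys P")
      (auto simp: lookup_sum lookup_single when_def sum.delta' in_keys_iff)
qed

lemma gpoly_eval_mult: "gpoly_eval (P * Q) \<gamma> = gpoly_eval P \<gamma> * gpoly_eval Q \<gamma>"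
proof -
  let ?mono = "\<lambda>P m. Poly_Mapping.single m (Poly_Mapping.lookup P m)"
  have "P * Q = (\<Sum>m\<in>Poly_Mapping.keys P. \<Sum>n\<in>Poly_Mapping.keys Q. ?mono P m * ?mono Q n)"
    unfolding sum_product[symmetric] sum_of_monomials ..
  then have "gpoly_eval (P * Q) \<gamma> =
    (\<Sum>m\<in>Poly_Mapping.keys P. \<Sum>n\<in>Poly_Mapping.keys Q.
      (Poly_Mapping.lookup P m * monomial_value \<gamma> m) * (Poly_Mapping.lookup Q n * monomial_value \<gamma> n))"
    by (simp add: gpoly_eval_sum mult_single gpoly_eval_single monomial_value_add algebra_simps)
  then show ?thesis
    unfolding gpoly_eval_def monomial_value_def by (simp add: sum_product)
qed

lemma gpoly_eval_one: "gpoly_eval 1 \<gamma> = 1"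
  by (simp flip: single_one add: gpoly_eval_single monomial_value_def)

lemma gpoly_eval_prod: "gpoly_eval (\<Prod>i\<in>I. f i) \<gamma> = (\<Prod>i\<in>I. gpoly_eval (f i) \<gamma>)"
  by (induction I rule: infinite_finite_induct) (simp_all add: gpoly_eval_mult gpoly_eval_one)

text \<open>The side conditions on a genericity polynomial, with the degree bound as a parameter to make
  them stable under products.\<close>

definition coefficient_poly :: "nat \<Rightarrow> 'a::field gpoly \<Rightarrow> bool" where
  "coefficient_poly n P \<longleftrightarrow>
    gpoly_vars P \<subseteq> {(i, j). i \<in> vertices \<and> j \<in> vertices \<and> i \<noteq> j} \<and> gpoly_degree_le P n"

lemma coefficient_poly_mono: "coefficient_poly m P \<Longrightarrow> m \<le> n \<Longrightarrow> coefficient_poly n P"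
  unfolding coefficient_poly_def gpoly_degree_le_def by (meson le_trans)

lemma coefficient_poly_mult:
  assumes "coefficient_poly m P" "coefficient_poly n Q"
  shows "coefficient_poly (m + n) (P * Q)"
proof -
  have "\<exists>p\<in>Poly_Mapping.keys P. \<exists>q\<in>Poly_Mapping.keys Q. k = p + q"
    if "k \<in> Poly_Mapping.keys (P * Q)" for k
    using keys_mult[of P Q] that by blast
  moreover have "Poly_Mapping.keys (p + q) \<subseteq> Poly_Mapping.keys p \<union> Poly_Mapping.keys q"
    for p q :: "nat \<times> nat \<Rightarrow>\<^sub>0 nat"
    by (rule Poly_Mapping.keys_add)
  ultimately have "gpoly_vars (P * Q) \<subseteq> gpoly_vars P \<union> gpoly_vars Q"
    unfolding gpoly_vars_def by fastforce
  moreover have "gpoly_degree_le (P * Q) (m + n)"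
    unfolding gpoly_degree_le_def monomial_degree_def[symmetric]
  proof
    fix k assume "k \<in> Poly_Mapping.keys (P * Q)"
    then obtain p q where pq: "p \<in> Poly_Mapping.keys P" "q \<in> Poly_Mapping.keys Q" "k = p + q"
      using keys_mult[of P Q] by blast
    then have "monomial_degree p \<le> m" "monomial_degree q \<le> n"
      using assms by (auto simp: coefficient_poly_def gpoly_degree_le_def monomial_degree_def)
    then show "monomial_degree k \<le> m + n"
      by (simp add: pq monomial_degree_add)
  qed
  ultimately show ?thesis
    using assms unfolding coefficient_poly_def by blast
qed

lemma coefficient_poly_prod:
  assumes "finite I" "\<And>i. i \<in> I \<Longrightarrow> coefficient_poly d (f i)"
  shows "coefficient_poly (card I * d) (\<Prod>i\<in>I. f i)"
  using assms
proof (induction I rule: finite_induct)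
  case empty
  show ?case
    by (simp add: coefficient_poly_def gpoly_vars_def gpoly_degree_le_def)
next
  case (insert i I)
  then show ?case
    using coefficient_poly_mult[of d "f i" "card I * d" "\<Prod>i\<in>I. f i"] by simp
qed

lemma coefficient_poly_add:
  assumes "coefficient_poly n P" "coefficient_poly n Q"
  shows "coefficient_poly n (P + Q)"
  using assms Poly_Mapping.keys_add[of P Q]
  unfolding coefficient_poly_def gpoly_vars_def gpoly_degree_le_def by blast

definition coeff_var :: "nat \<Rightarrow> nat \<Rightarrow> 'a::field gpoly" where
  "coeff_var i j = Poly_Mapping.single (Poly_Mapping.single (i, j) 1) 1"

definition tri_det_poly :: "nat \<Rightarrow> nat \<Rightarrow> nat \<Rightarrow> 'a::field gpoly" where
  "tri_det_poly a b c = coeff_var a b * coeff_var b c * coeff_var c a +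
     coeff_var a c * coeff_var c b * coeff_var b a"

lemma gpoly_eval_coeff_var: "gpoly_eval (coeff_var i j) \<gamma> = \<gamma> i j"
  by (simp add: coeff_var_def gpoly_eval_single monomial_value_def)

lemma gpoly_eval_tri_det_poly: "gpoly_eval (tri_det_poly a b c) \<gamma> = tri_det \<gamma> a b c"
  by (simp add: tri_det_poly_def tri_det_def gpoly_eval_add gpoly_eval_mult gpoly_eval_coeff_var)

lemma coefficient_poly_coeff_var:
  "vertex_list [i, j] \<Longrightarrow> coefficient_poly 1 (coeff_var i j)"
  by (simp add: coefficient_poly_def coeff_var_def gpoly_vars_def gpoly_degree_le_def)

lemma coefficient_poly_tri_det_poly:
  assumes "vertex_list [a, b, c]"
  shows "coefficient_poly 3 (tri_det_poly a b c)"
proof -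
  have "coefficient_poly (1 + 1 + 1) (tri_det_poly a b c)"
    unfolding tri_det_poly_def
    by (intro coefficient_poly_add coefficient_poly_mult coefficient_poly_coeff_var) (use assms in auto)
  then show ?thesis by (simp add: numeral_3_eq_3)
qed

lemma coeff_var_nonzero: "coeff_var i j \<noteq> (0 :: 'a::field gpoly)"
proof
  assume "coeff_var i j = (0 :: 'a gpoly)"
  then have "Poly_Mapping.lookup (coeff_var i j :: 'a gpoly) (Poly_Mapping.single (i, j) 1) = 0"
    by simp
  then show False by (simp add: coeff_var_def)
qed

text \<open>The two monomials differ, so no cancellation occurs in any characteristic.\<close>

lemma tri_det_poly_nonzero:
  assumes "distinct [a, b, c]"
  shows "tri_det_poly a b c \<noteq> (0 :: 'a::field gpoly)"
proof
  let ?x = "\<lambda>i j. Poly_Mapping.single (i, j) (1 :: nat)"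
  let ?m = "?x a b + ?x b c + ?x c a" and ?n = "?x a c + ?x c b + ?x b a"
  have "Poly_Mapping.lookup ?m (a, b) \<noteq> Poly_Mapping.lookup ?n (a, b)"
    using assms by (auto simp: lookup_add lookup_single when_def)
  then have neq: "?n \<noteq> ?m" by metis
  assume "tri_det_poly a b c = (0 :: 'a gpoly)"
  moreover have "tri_det_poly a b c = Poly_Mapping.single ?m 1 + Poly_Mapping.single ?n (1 :: 'a)"
    by (simp add: tri_det_poly_def coeff_var_def mult_single)
  ultimately have "Poly_Mapping.lookup (Poly_Mapping.single ?m 1 + Poly_Mapping.single ?n (1 :: 'a)) ?m = 0"
    by simp
  then show False
    using neq by (simp add: lookup_add lookup_single when_def)
qed

text \<open>The product runs over all ordered pairs and triples of distinct vertices.  It is nonzero because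
  polynomials over a field form an integral domain, for which the lexicographic order on the index
  pairs of the variables is used.\<close>

lemma generic_coefficients_generically: "holds_generically (generic_coefficients :: (nat \<Rightarrow> nat \<Rightarrow> 'a::field) \<Rightarrow> bool)"
proof -
  define I where "I = {(i, j). vertex_list [i, j]}"
  define J where "J = {(a, b, c). vertex_list [a, b, c]}"
  have I: "I \<subseteq> vertices \<times> vertices" and J: "J \<subseteq> vertices \<times> vertices \<times> vertices"
    by (auto simp: I_def J_def)
  have fin: "finite (vertices \<times> vertices)" "finite (vertices \<times> vertices \<times> vertices)"
    by (simp_all add: vertices_def)
  have fin_I: "finite I" and fin_J: "finite J"
    using finite_subset[OF I fin(1)] finite_subset[OF J fin(2)] by auto
  \<comment> \<open>Crude bounds are enough: the degree is at most \<open>36 + 3 * 216\<close>.\<close>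
  have card: "card I \<le> 36" "card J \<le> 216"
    using card_mono[OF fin(1) I] card_mono[OF fin(2) J]
    by (simp_all add: card_cartesian_product) (simp_all add: vertices_def)
  define P :: "'a gpoly" where
    "P = (\<Prod>(i, j)\<in>I. coeff_var i j) * (\<Prod>(a, b, c)\<in>J. tri_det_poly a b c)"
  have "P \<noteq> 0"
    using fin_I fin_J by (auto simp: P_def I_def J_def coeff_var_nonzero tri_det_poly_nonzero)
  moreover have "coefficient_poly (10 ^ 6) P"
  proof -
    have "coefficient_poly (card I * 1) (\<Prod>(i, j)\<in>I. coeff_var i j :: 'a gpoly)"
      by (rule coefficient_poly_prod[OF fin_I]) (auto simp: I_def simp del: One_nat_def intro!: coefficient_poly_coeff_var)
    moreover have "coefficient_poly (card J * 3) (\<Prod>(a, b, c)\<in>J. tri_det_poly a b c :: 'a gpoly)"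
      by (rule coefficient_poly_prod[OF fin_J]) (auto simp: J_def intro!: coefficient_poly_tri_det_poly)
    ultimately have "coefficient_poly (card I * 1 + card J * 3) P"
      unfolding P_def by (rule coefficient_poly_mult)
    then show ?thesis
      by (rule coefficient_poly_mono) (use card in simp)
  qed
  moreover have "generic_coefficients \<gamma>" if "gpoly_eval P \<gamma> \<noteq> 0" for \<gamma>
  proof -
    have "(\<Prod>(i, j)\<in>I. \<gamma> i j) \<noteq> 0" "(\<Prod>(a, b, c)\<in>J. tri_det \<gamma> a b c) \<noteq> 0"
      using that by (simp_all add: P_def gpoly_eval_mult gpoly_eval_prod case_prod_unfold
          gpoly_eval_coeff_var gpoly_eval_tri_det_poly)
    then have "\<forall>(i, j)\<in>I. \<gamma> i j \<noteq> 0" "\<forall>(a, b, c)\<in>J. tri_det \<gamma> a b c \<noteq> 0"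
      using fin_I fin_J by (auto simp: case_prod_unfold)
    then show ?thesis
      by unfold_locales (auto simp: I_def J_def)
  qed
  ultimately show ?thesis
    unfolding holds_generically_def coefficient_poly_def by blast
qed

theorem theorem2:
  shows "holds_generically (\<lambda>\<gamma> :: nat \<Rightarrow> nat \<Rightarrow> 'a::field.
    full_hexagon \<gamma> (\<lambda>k. if k \<le> 3 then 0 else if k = 4 then 1 else 4) \<and>
    coloring.subspace (permitted \<gamma> pentachora) \<and>
    coloring.dim (permitted \<gamma> pentachora) = 9)"
  using generic_coefficients_generically[where 'a = 'a]
    generic_coefficients.full_hexagon_generic[where 'a = 'a]
    generic_coefficients.dim_permitted_pentachora[where 'a = 'a]
    subspace_permitted[where 'a = 'a]
  unfolding holds_generically_def by blast

end
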